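(* Let $d,n \in \mathbb{N}$, $\theta,\kappa,\gamma \geq 0$, and $C_0 \geq 1$. Assume that for every $\varepsilon \in (0,1)$ and every $g \in \mathcal{F}_{n,d}$ there exists a function $g_\varepsilon$ implemented by a $\sigma$-network (with input dimension $d$ and output dimension $1$) with at most $C_0 \cdot (\ln(2/\varepsilon))^{\kappa}$ layers and at most $C_0 \cdot \varepsilon^{-\gamma}$ weights, all bounded in absolute value by $C_0 \cdot \varepsilon^{-\theta}$, satisfying $\| g - g_\varepsilon \|_{L^\infty(Q_{\mathbb{C}^d})} \leq \frac{\varepsilon}{2}$. Then necessarily $\gamma \geq 2d/n$.
   Context: **modReLU.** $\sigma : \mathbb{C} \to \mathbb{C}$ is given by $\sigma(z) = 0$ if $|z| \leq 1$ and $\sigma(z) = z - \frac{z}{|z|}$ if $|z| \geq 1$. **Networks.** A ($\sigma$-)network is a tuple $\Phi = ((A_1,b_1),\dots,(A_L,b_L))$ with $L \in \mathbb{N}$, $A_\ell \in \mathbb{C}^{N_\ell \times N_{\ell-1}}$, $b_\ell \in \mathbb{C}^{N_\ell}$; its input dimension is $N_0$, its output dimension is $N_L$. Its realization is $R_\sigma \Phi := T_L \circ (\sigma \circ T_{L-1}) \circ \cdots \circ (\sigma \circ T_1) : \mathbb{C}^{N_0} \to \mathbb{C}^{N_L}$, where $T_\ell\, \boldsymbol{z} = A_\ell \boldsymbol{z} + b_\ell$ and $\sigma$ acts componentwise. A function is implemented by $\Phi$ if it equals $R_\sigma \Phi$. The number of layers is $L$; the number of weights is $\sum_{\ell=1}^L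 (\|A_\ell\|_{\ell^0} + \|b_\ell\|_{\ell^0})$, where $\|\cdot\|_{\ell^0}$ counts nonzero entries. The weights are bounded by $K$ if all entries of all $A_\ell$ and $b_\ell$ have absolute value at most $K$. **Function class.** $Q_{\mathbb{C}^d} := \{ \boldsymbol{z} \in \mathbb{C}^d : \operatorname{Re} z_k, \operatorname{Im} z_k \in [0,1] \text{ for } 1 \leq k \leq d\}$, identified with $[0,1]^{2d}$ via $\boldsymbol{z} \mapsto (\operatorname{Re} z_1,\dots,\operatorname{Re} z_d, \operatorname{Im} z_1,\dots,\operatorname{Im} z_d)$. A function $f : [0,1]^{2d} \to \mathbb{R}$ belongs to $\mathcal{W}^{n,\infty}([0,1]^{2d};\mathbb{R})$ if it is $n-1$ times continuously differentiable with all derivatives of order $n-1$ Lipschitz continuous, and $\|f\|_{\mathcal{W}^{n,\infty}} := \max\{ \max_{|\alpha| \leq n-1} \|\partial^\alpha f\|_{L^\infty}, \max_{|\alpha| = n-1} \mathrm{Lip}(\partial^\alpha f)\}$, where $\mathrm{Lip}$ denotes the Lipschitz constant. Then $F_{n,d} := \{ f \in \mathcal{W}^{n,\infty}([0,1]^{2d};\mathbb{R}) : \|f\|_{\mathcal{W}^{n,\infty}} \leq 1\}$ and $\mathcal{F}_{n,d}$ is the set of all $g : Q_{\mathbb{C}^d} \to \mathbb{C}$ such that $\operatorname{Re}(g)$ and $\operatorname{Im}(g)$, viewed as functions on $[0,1]^{2d}$ via the identification $\boldsymbol{z} \mapsto (\operatorname{Re} z_1,\dots,\operatorname{Re} z_d,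 \operatorname{Im} z_1,\dots,\operatorname{Im} z_d)$ of $Q_{\mathbb{C}^d}$ with $[0,1]^{2d}$, both lie in $F_{n,d}$. *)

theory Defs
  imports
    "HOL-Analysis.Analysis"
    "HOL-Probability.Essential_Supremum"
    "Jordan_Normal_Form.Matrix"
begin

definition modReLU :: "complex \<Rightarrow> complex" where
  "modReLU z = (if cmod z \<le> 1 then 0 else z - z / complex_of_real (cmod z))"


text \<open>A network is the list of its layers \<open>(A, b)\<close>, first layer first. All layer widths are
  positive.\<close>

type_synonym network = "(complex mat \<times> complex Matrix.vec) list"

definition is_network :: "nat \<Rightarrow> nat \<Rightarrow> network \<Rightarrow> bool" where
  "is_network d_in d_out \<Phi> \<longleftrightarrow> \<Phi> \<noteq> [] \<and>
     (\<exists>N :: nat \<Rightarrow> nat. N 0 = d_in \<and> N (length \<Phi>) = d_out \<and> (\<forall>l\<le>length \<Phi>. 0 < N l) \<and>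
        (\<forall>l<length \<Phi>. fst (\<Phi> ! l) \<in> carrier_mat (N (Suc l)) (N l) \<and>
                      snd (\<Phi> ! l) \<in> carrier_vec (N (Suc l))))"

text \<open>The activation is not applied after the last layer. The equation for \<open>[]\<close> is a dummy.\<close>

fun realization :: "(complex \<Rightarrow> complex) \<Rightarrow> network \<Rightarrow> complex Matrix.vec \<Rightarrow> complex Matrix.vec" where
  "realization \<sigma> [] z = z"
| "realization \<sigma> [(A, b)] z = A *\<^sub>v z + b"
| "realization \<sigma> ((A, b) # layer # \<Phi>) z = realization \<sigma> (layer # \<Phi>) (map_vec \<sigma> (A *\<^sub>v z + b))"

definition num_weights :: "network \<Rightarrow> nat" where
  "num_weights \<Phi> = (\<Sum>(A, b) \<leftarrow> \<Phi>.
      card {(i, j). i < dim_row A \<and> j < dim_col A \<and> A $$ (i, j) \<noteq> 0} +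
      card {i. i < dim_vec b \<and> vec_index b i \<noteq> 0})"

definition weights_bounded :: "real \<Rightarrow> network \<Rightarrow> bool" where
  "weights_bounded K \<Phi> \<longleftrightarrow> (\<forall>(A, b) \<in> set \<Phi>.
      (\<forall>i<dim_row A. \<forall>j<dim_col A. cmod (A $$ (i, j)) \<le> K) \<and>
      (\<forall>i<dim_vec b. cmod (vec_index b i) \<le> K))"

text \<open>Networks act on vectors indexed by \<open>{0..<d}\<close>, whereas \<open>complex ^ 'd\<close> is indexed by a finite
  type. On a finite type \<^const>\<open>from_nat_into\<close> is a bijection from \<open>{..<CARD('d)}\<close>; which
  bijection it is does not matter, as another one amounts to permuting the columns of the first
  matrix, which changes neither the weight count nor the weight bound.\<close>

definition coord_vec :: "complex ^ 'd \<Rightarrow> complex Matrix.vec" where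
  "coord_vec z = Matrix.vec CARD('d) (\<lambda>i. vec_nth z (from_nat_into UNIV i))"

definition implements :: "network \<Rightarrow> (complex ^ 'd \<Rightarrow> complex) \<Rightarrow> bool" where
  "implements \<Phi> f \<longleftrightarrow> is_network CARD('d) 1 \<Phi> \<and>
     (\<forall>z. realization modReLU \<Phi> (coord_vec z) = Matrix.vec 1 (\<lambda>_. f z))"


definition Linf_norm :: "'a :: euclidean_space set \<Rightarrow> ('a \<Rightarrow> 'b :: real_normed_vector) \<Rightarrow> ereal" where
  "Linf_norm S f = esssup (lebesgue_on S) (\<lambda>x. ereal (norm (f x)))"

text \<open>The value is \<open>\<infinity>\<close> if \<open>f\<close> is not Lipschitz on \<open>S\<close>.\<close>

definition Lip_const :: "'a :: metric_space set \<Rightarrow> ('a \<Rightarrow> 'b :: metric_space) \<Rightarrow> ereal" where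
  "Lip_const S f = Inf {ereal L | L. L-lipschitz_on S f}"

definition multi_order :: "nat ^ 'm \<Rightarrow> nat" where
  "multi_order \<alpha> = (\<Sum>i\<in>UNIV. vec_nth \<alpha> i)"

text \<open>\<open>D \<alpha>\<close> is the partial derivative of \<open>f\<close> of multi-index \<open>\<alpha>\<close> on \<open>S\<close>, for \<open>\<alpha>\<close> of order at most \<open>k\<close>,
  and all of these are continuous on \<open>S\<close>. Derivatives are taken within \<open>S\<close>, hence one-sided on the
  boundary. On a box with nonempty interior, the values \<open>D \<alpha> x\<close> with \<open>x \<in> S\<close> and \<open>\<alpha>\<close> of order at
  most \<open>k\<close> are determined by \<open>f\<close>; \<open>derivative_family_unique\<close> below shows this for the unit cube.\<close>

definition derivative_family ::
    "nat \<Rightarrow> (real ^ 'm) set \<Rightarrow> (real ^ 'm \<Rightarrow> real) \<Rightarrow> (nat ^ 'm \<Rightarrow> real ^ 'm \<Rightarrow> real) \<Rightarrow> bool" where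
  "derivative_family k S f D \<longleftrightarrow>
     (\<forall>x\<in>S. D 0 x = f x) \<and>
     (\<forall>\<alpha>. multi_order \<alpha> < k \<longrightarrow> (\<forall>x\<in>S.
        (D \<alpha> has_derivative (\<lambda>h. \<Sum>i\<in>UNIV. D (\<alpha> + axis i 1) x * vec_nth h i)) (at x within S))) \<and>
     (\<forall>\<alpha>. multi_order \<alpha> \<le> k \<longrightarrow> continuous_on S (D \<alpha>))"

definition cont_differentiable :: "nat \<Rightarrow> (real ^ 'm) set \<Rightarrow> (real ^ 'm \<Rightarrow> real) \<Rightarrow> bool" where
  "cont_differentiable k S f \<longleftrightarrow> (\<exists>D. derivative_family k S f D)"

definition partial_deriv ::
    "(real ^ 'm) set \<Rightarrow> nat ^ 'm \<Rightarrow> (real ^ 'm \<Rightarrow> real) \<Rightarrow> real ^ 'm \<Rightarrow> real" where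
  "partial_deriv S \<alpha> f = (SOME D. derivative_family (multi_order \<alpha>) S f D) \<alpha>"

text \<open>Functions on a set \<open>S\<close> are total functions of which only the values on \<open>S\<close> matter.\<close>

definition sobolev_space :: "nat \<Rightarrow> (real ^ 'm) set \<Rightarrow> (real ^ 'm \<Rightarrow> real) set" where
  "sobolev_space n S = {f. cont_differentiable (n - 1) S f \<and>
     (\<forall>\<alpha>. multi_order \<alpha> = n - 1 \<longrightarrow> (\<exists>L. L-lipschitz_on S (partial_deriv S \<alpha> f)))}"

definition sobolev_norm :: "nat \<Rightarrow> (real ^ 'm) set \<Rightarrow> (real ^ 'm \<Rightarrow> real) \<Rightarrow> ereal" where
  "sobolev_norm n S f = max
     (MAX \<alpha> \<in> {\<alpha>. multi_order \<alpha> \<le> n - 1}. Linf_norm S (partial_deriv S \<alpha> f))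
     (MAX \<alpha> \<in> {\<alpha>. multi_order \<alpha> = n - 1}. Lip_const S (partial_deriv S \<alpha> f))"

definition unit_cube :: "(real ^ 'm) set" where
  "unit_cube = {x. \<forall>i. vec_nth x i \<in> {0..1}}"

lemma unit_cube_eq_cbox: "unit_cube = cbox (0 :: real ^ 'm) 1"
  by (auto simp: unit_cube_def cbox_def Basis_vec_def cart_eq_inner_axis[symmetric] inner_axis)

lemma derivative_family_unique:
  fixes D E :: "nat ^ 'm \<Rightarrow> real ^ 'm \<Rightarrow> real"
  assumes D: "derivative_family k unit_cube f D" and E: "derivative_family l unit_cube f E"
    and "multi_order \<alpha> \<le> k" "multi_order \<alpha> \<le> l" "x \<in> unit_cube"
  shows "D \<alpha> x = E \<alpha> x"
  using assms(3-)
proof (induction "multi_order \<alpha>" arbitrary: \<alpha> x)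
  case 0
  then have "\<alpha> = 0" by (simp add: multi_order_def Finite_Cartesian_Product.vec_eq_iff)
  with D E 0 show ?case by (simp add: derivative_family_def)
next
  case (Suc m)
  have "\<exists>i. vec_nth \<alpha> i \<noteq> 0"
  proof (rule ccontr)
    assume "\<nexists>i. vec_nth \<alpha> i \<noteq> 0"
    with Suc.hyps(2) show False by (simp add: multi_order_def)
  qed
  then obtain i where i: "vec_nth \<alpha> i \<noteq> 0" by blast
  define \<beta> where "\<beta> = (\<chi> j. if j = i then vec_nth \<alpha> j - 1 else vec_nth \<alpha> j)"
  have \<alpha>: "\<alpha> = \<beta> + axis i 1" using i by (auto simp: \<beta>_def Finite_Cartesian_Product.vec_eq_iff axis_def)
  have "multi_order \<alpha> = multi_order \<beta> + 1"
    unfolding \<alpha> multi_order_def by (simp add: sum.distrib axis_def)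
  with Suc.hyps(2) have m: "multi_order \<beta> = m" by simp
  have k: "multi_order \<beta> < k" "multi_order \<beta> < l" using Suc.hyps(2) Suc.prems m by auto
  let ?L = "\<lambda>(D :: nat ^ 'm \<Rightarrow> real ^ 'm \<Rightarrow> real) h :: real ^ 'm.
    \<Sum>j\<in>UNIV. D (\<beta> + axis j 1) x * vec_nth h j"
  have d: "(D \<beta> has_derivative ?L D) (at x within unit_cube)"
    using D k Suc.prems(3) by (simp add: derivative_family_def)
  have e: "(E \<beta> has_derivative ?L E) (at x within unit_cube)"
    using E k Suc.prems(3) by (simp add: derivative_family_def)
  have "D \<beta> y = E \<beta> y" if "y \<in> unit_cube" for y
    using Suc.hyps(1)[of \<beta> y] m k that by simp
  with e have e': "(D \<beta> has_derivative ?L E) (at x within unit_cube)"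
    using Suc.prems(3) by (metis (no_types, lifting) has_derivative_transform)
  have "?L D = ?L E"
  proof (rule frechet_derivative_unique_within_closed_interval)
    show "(0 :: real ^ 'm) \<bullet> b < 1 \<bullet> b" if "b \<in> Basis" for b
      using that by (auto simp: Basis_vec_def inner_axis)
    show "(D \<beta> has_derivative ?L D) (at x within cbox 0 1)"
      "(D \<beta> has_derivative ?L E) (at x within cbox 0 1)" "x \<in> cbox 0 1"
      using d e' Suc.prems(3) unfolding unit_cube_eq_cbox by simp_all
  qed
  then have "?L D (axis i 1) = ?L E (axis i 1)" by metis
  then show ?case by (simp add: axis_def if_distrib[of "(*) _"] \<alpha> cong: if_cong)
qed

lemma partial_deriv_eq:
  assumes "derivative_family k unit_cube f D" "multi_order \<alpha> \<le> k" "x \<in> unit_cube"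
  shows "partial_deriv unit_cube \<alpha> f x = D \<alpha> x"
proof -
  have "derivative_family (multi_order \<alpha>) unit_cube f D"
    using assms by (simp add: derivative_family_def)
  then have "derivative_family (multi_order \<alpha>) unit_cube f
      (SOME D. derivative_family (multi_order \<alpha>) unit_cube f D)"
    by (rule someI[where P = "derivative_family (multi_order \<alpha>) unit_cube f"])
  from derivative_family_unique[OF this assms(1) order_refl assms(2,3)] show ?thesis
    by (simp add: partial_deriv_def)
qed

definition sobolev_ball :: "nat \<Rightarrow> (real ^ 'm \<Rightarrow> real) set" where
  "sobolev_ball n = {f \<in> sobolev_space n unit_cube. sobolev_norm n unit_cube f \<le> 1}"


definition complex_cube :: "(complex ^ 'd) set" where
  "complex_cube = {z. \<forall>k. Re (vec_nth z k) \<in> {0..1} \<and> Im (vec_nth z k) \<in> {0..1}}"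

text \<open>\<open>\<real>\<^sup>2\<^sup>d\<close> is \<open>real ^ ('d + 'd)\<close>: real parts come first (\<^const>\<open>Inl\<close>), then imaginary parts
  (\<^const>\<open>Inr\<close>).\<close>

definition realify :: "complex ^ 'd \<Rightarrow> real ^ ('d + 'd)" where
  "realify z = (\<chi> i. case i of Inl k \<Rightarrow> Re (vec_nth z k) | Inr k \<Rightarrow> Im (vec_nth z k))"

lemma bij_betw_realify: "bij_betw realify (complex_cube :: (complex ^ 'd) set) unit_cube"
proof (rule bij_betw_byWitness)
  let ?inv = "\<lambda>x :: real ^ ('d + 'd). \<chi> k. Complex (vec_nth x (Inl k)) (vec_nth x (Inr k))"
  show "\<forall>z\<in>complex_cube. ?inv (realify z) = z" by (simp add: realify_def Finite_Cartesian_Product.vec_eq_iff)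
  show "\<forall>x\<in>unit_cube. realify (?inv x) = x"
    by (auto simp: realify_def Finite_Cartesian_Product.vec_eq_iff split: sum.split)
  show "realify ` complex_cube \<subseteq> unit_cube"
    by (auto simp: realify_def complex_cube_def unit_cube_def split: sum.split)
  show "?inv ` unit_cube \<subseteq> complex_cube" by (auto simp: complex_cube_def unit_cube_def)
qed

definition target_class :: "nat \<Rightarrow> (complex ^ 'd \<Rightarrow> complex) set" where
  "target_class n = {g. \<exists>u \<in> sobolev_ball n. \<exists>v \<in> sobolev_ball n.
     \<forall>z \<in> complex_cube. Re (g z) = u (realify z) \<and> Im (g z) = v (realify z)}"

end

theory Submission
  imports Defs "HOL-Computational_Algebra.Polynomial" "HOL-Real_Asymp.Real_Asymp"
begin

text \<open>The proof compares two counts. On the one hand, the class contains very many functions that are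
  far apart: divide the cube \<open>[0,1]\<^sup>m\<close>, \<open>m = 2d\<close>, into \<open>N\<^sup>m\<close> cells and switch on a sufficiently smooth bump of height
  \<open>h \<approx> N\<^sup>-\<^sup>n\<close> in an arbitrary subset of the cells. Each of these \<open>2 ^ (N ^ m)\<close> functions has Sobolev norm
  at most 1, because rescaling a bump to side length \<open>1/N\<close> multiplies its derivatives of order \<open>n\<close> by
  \<open>N\<^sup>n\<close> and the bumps have disjoint supports; any two of them differ by \<open>h\<close> somewhere. On the other hand,
  networks of bounded size realize few functions: after rounding every weight to a fine grid there
  are only finitely many networks of a given size, and rounding hardly changes the realization.

  Put \<open>\<epsilon> = h / 2\<close>. By assumption, every bump function is within \<open>\<epsilon> / 2\<close> of a network, hence within
  \<open>3 \<epsilon> / 4\<close> of a rounded network (almost everywhere). As \<open>2 * (3 \<epsilon> / 4) < h\<close>, distinct bump functions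
  belong to distinct rounded networks, so there are at least \<open>2 ^ (N ^ m)\<close> of the latter
  (\<open>packing_le_covering\<close>).

  The number of rounded networks is bounded in \<open>network_covering\<close>. A perturbation of the weights is
  amplified by at most a factor \<open>K (R + 1)\<close> per layer, where \<open>K\<close> bounds the weights and \<open>R\<close> the width, so
  a grid whose step is about \<open>(K (R + 1))\<^sup>-\<^sup>L\<close> suffices for \<open>L\<close> layers. A network with \<open>W\<close> nonzero weights
  may be assumed to have width about \<open>W\<close>, since a neuron without any nonzero incoming weight outputs
  \<open>0\<close> and can be removed (\<open>prune_dead_neurons\<close>). Such a network is then given by the positions and the
  rounded values of its at most \<open>W\<close> nonzero weights, and the logarithm of the number of possibilities
  is at most of order \<open>L W log (K W L / \<epsilon>)\<close>.

  Here \<open>L\<close> is polylogarithmic in \<open>1 / \<epsilon>\<close>, \<open>K\<close> is polynomial and \<open>W\<close> is at most of order \<open>\<epsilon> powr (- \<gamma>)\<close>,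
  while \<open>N ^ m\<close> is of order \<open>\<epsilon> powr (- m / n)\<close>. Comparing the two counts as \<open>N \<rightarrow> \<infinity>\<close> gives
  \<open>\<gamma> \<ge> m / n\<close>.\<close>

section \<open>The activation function\<close>

lemma modReLU_zero [simp]: "modReLU 0 = 0"
  by (simp add: modReLU_def)

lemma norm_modReLU_le: "cmod (modReLU z) \<le> cmod z"
proof (cases "cmod z \<le> 1")
  case False
  then have "modReLU z = complex_of_real (1 - 1 / cmod z) * z"
    by (simp add: modReLU_def algebra_simps)
  then have "cmod (modReLU z) = (1 - 1 / cmod z) * cmod z"
    using False by (simp add: norm_mult abs_of_nonneg divide_le_eq del: of_real_diff)
  also have "\<dots> \<le> 1 * cmod z" by (intro mult_right_mono) auto
  finally show ?thesis by simp
qed (simp add: modReLU_def)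

text \<open>The activation is the identity minus the projection onto the closed unit disc, which explains the
  bound. The proof is by squaring: with \<open>a\<close>, \<open>b\<close> the moduli of \<open>z\<close>, \<open>w\<close> and \<open>c\<close> their inner product, the
  difference of the two squared distances is \<open>2 (a + b - 1) (1 - c / (a b))\<close> outside the disc, and this
  is nonnegative by the Cauchy-Schwarz inequality.\<close>
lemma modReLU_nonexpansive: "cmod (modReLU z - modReLU w) \<le> cmod (z - w)"
proof -
  have scale: "modReLU u = complex_of_real (1 - 1 / cmod u) * u \<and> cmod (modReLU u) = cmod u - 1"
    if "1 < cmod u" for u
  proof -
    have *: "modReLU u = complex_of_real (1 - 1 / cmod u) * u"
      using that by (simp add: modReLU_def algebra_simps)
    have "cmod (modReLU u) = (1 - 1 / cmod u) * cmod u"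
      unfolding * using that by (simp add: norm_mult abs_of_nonneg divide_le_eq del: of_real_diff)
    also have "\<dots> = cmod u - 1" using that by (auto simp: field_simps)
    finally show ?thesis using * by simp
  qed
  have mixed: "cmod (modReLU u - modReLU v) \<le> cmod (u - v)" if "1 < cmod u" "cmod v \<le> 1" for u v
  proof -
    have "modReLU v = 0" using that by (simp add: modReLU_def)
    then have "cmod (modReLU u - modReLU v) = cmod u - 1" using conjunct2[OF scale[OF that(1)]] by simp
    also have "\<dots> \<le> cmod u - cmod v" using that by simp
    also have "\<dots> \<le> cmod (u - v)" by (rule norm_triangle_ineq2)
    finally show ?thesis .
  qed
  consider "cmod z \<le> 1" "cmod w \<le> 1" | "1 < cmod z" "cmod w \<le> 1" | "cmod z \<le> 1" "1 < cmod w"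
    | "1 < cmod z" "1 < cmod w" by linarith
  then show ?thesis
  proof cases
    case 1 then show ?thesis by (simp add: modReLU_def)
  next
    case 2 then show ?thesis by (rule mixed)
  next
    case 3 then show ?thesis using mixed[of w z] by (simp add: norm_minus_commute)
  next
    case 4
    define a b where "a = cmod z" and "b = cmod w"
    have ab: "1 < a" "1 < b" using 4 by (simp_all add: a_def b_def)
    define c where "c = z \<bullet> w"
    have c: "c \<le> a * b" unfolding c_def a_def b_def by (rule norm_cauchy_schwarz)
    have sq: "cmod (complex_of_real s * z - complex_of_real t * w)^2 = (s * a)^2 + (t * b)^2 - 2 * (s * t) * c"
      for s t
    proof -
      have "cmod (complex_of_real s * z - complex_of_real t * w)^2
          = (s *\<^sub>R z - t *\<^sub>R w) \<bullet> (s *\<^sub>R z - t *\<^sub>R w)"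
        by (simp add: power2_norm_eq_inner scaleR_conv_of_real)
      also have "\<dots> = s^2 * (z \<bullet> z) + t^2 * (w \<bullet> w) - 2 * (s * t) * (z \<bullet> w)"
        by (simp add: inner_diff_left inner_diff_right inner_commute[of w z] power2_eq_square algebra_simps)
      finally show ?thesis
        by (simp add: a_def b_def c_def power2_norm_eq_inner power_mult_distrib)
    qed
    have "cmod (z - w)^2 = a^2 + b^2 - 2 * c" using sq[of 1 1] by simp
    moreover have "cmod (modReLU z - modReLU w)^2
        = (a - 1)^2 + (b - 1)^2 - 2 * ((1 - 1 / a) * (1 - 1 / b)) * c"
    proof -
      have "(1 - 1 / a) * a = a - 1" "(1 - 1 / b) * b = b - 1" using ab by (simp_all add: field_simps)
      then show ?thesis
        using scale[OF 4(1)] scale[OF 4(2)] sq[of "1 - 1 / a" "1 - 1 / b"] by (simp add: a_def b_def)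
    qed
    moreover have "a^2 + b^2 - 2 * c - ((a - 1)^2 + (b - 1)^2 - 2 * ((1 - 1 / a) * (1 - 1 / b)) * c)
        = 2 * (a + b - 1) * (1 - c / (a * b))"
      using ab by (simp add: field_simps power2_eq_square)
    moreover have "0 \<le> 2 * (a + b - 1) * (1 - c / (a * b))"
      using ab c by (intro mult_nonneg_nonneg) (auto simp: divide_le_eq_1)
    ultimately have "cmod (modReLU z - modReLU w)^2 \<le> cmod (z - w)^2" by linarith
    then show ?thesis by (rule power2_le_imp_le) simp
  qed
qed

section \<open>Networks as sparse weight functions\<close>
type_synonym weights = "nat \<times> nat \<times> nat \<Rightarrow> complex"

text \<open>The weights of all layers are collected in one function of layer, row and column; column \<open>0\<close> holds the
  bias, and the weight on the input \<open>j\<close> stands in column \<open>Suc j\<close>. The actual widths of the layers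
  disappear: out-of-range entries are \<open>0\<close>, and a number \<open>R\<close> that bounds all widths serves as a
  common summation range. Sparsity is then just the size of the support, and two networks can be
  compared weight by weight.\<close>
definition affine_row :: "nat \<Rightarrow> weights \<Rightarrow> nat \<Rightarrow> (nat \<Rightarrow> complex) \<Rightarrow> nat \<Rightarrow> complex" where
  "affine_row R \<theta> l v i = \<theta> (l, i, 0) + (\<Sum>j<R. \<theta> (l, i, Suc j) * v j)"

fun hidden :: "nat \<Rightarrow> weights \<Rightarrow> (nat \<Rightarrow> complex) \<Rightarrow> nat \<Rightarrow> nat \<Rightarrow> complex" where
  "hidden R \<theta> x 0 i = x i"
| "hidden R \<theta> x (Suc l) i = modReLU (affine_row R \<theta> l (hidden R \<theta> x l) i)"

definition net_output :: "nat \<Rightarrow> weights \<Rightarrow> (nat \<Rightarrow> complex) \<Rightarrow> nat \<Rightarrow> complex" where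
  "net_output R \<theta> x L = affine_row R \<theta> (L - 1) (hidden R \<theta> x (L - 1)) 0"

definition weights_of :: "network \<Rightarrow> weights" where
  "weights_of \<Phi> = (\<lambda>(l, i, j).
     if l < length \<Phi> then
       (case j of 0 \<Rightarrow> if i < dim_vec (snd (\<Phi> ! l)) then vec_index (snd (\<Phi> ! l)) i else 0
        | Suc j' \<Rightarrow> if i < dim_row (fst (\<Phi> ! l)) \<and> j' < dim_col (fst (\<Phi> ! l))
                    then fst (\<Phi> ! l) $$ (i, j') else 0)
     else 0)"

abbreviation supp :: "('a \<Rightarrow> 'b::zero) \<Rightarrow> 'a set" where
  "supp f \<equiv> {a. f a \<noteq> 0}"

lemma weights_of_Cons_Suc: "weights_of (p # \<Phi>) (Suc l, i, j) = weights_of \<Phi> (l, i, j)"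
  by (cases j) (simp_all add: weights_of_def)

text \<open>Splitting off the first layer lets the support be counted by induction over the list of layers.\<close>
lemma supp_weights_of_Cons:
  "supp (weights_of (p # \<Phi>)) =
     (\<lambda>(i, j). (0, i, Suc j)) ` {(i, j). i < dim_row (fst p) \<and> j < dim_col (fst p) \<and> fst p $$ (i, j) \<noteq> 0} \<union>
     (\<lambda>i. (0, i, 0)) ` {i. i < dim_vec (snd p) \<and> vec_index (snd p) i \<noteq> 0} \<union>
     (\<lambda>(l, i, j). (Suc l, i, j)) ` supp (weights_of \<Phi>)" (is "?L = ?A \<union> ?B \<union> ?C")
proof (rule Set.set_eqI)
  fix t :: "nat \<times> nat \<times> nat"
  obtain l i j where t: "t = (l, i, j)" by (cases t)
  show "t \<in> ?L \<longleftrightarrow> t \<in> ?A \<union> ?B \<union> ?C"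
  proof (cases l)
    case 0
    then show ?thesis unfolding t by (cases j) (auto simp: weights_of_def)
  next
    case (Suc l')
    have "t \<in> ?C \<longleftrightarrow> weights_of \<Phi> (l', i, j) \<noteq> 0"
      unfolding t Suc by (auto simp: image_iff)
    moreover have "t \<notin> ?A \<union> ?B" unfolding t Suc by auto
    ultimately show ?thesis unfolding t Suc by (simp add: weights_of_Cons_Suc)
  qed
qed

lemma card_supp_weights_of:
  "finite (supp (weights_of \<Phi>)) \<and> card (supp (weights_of \<Phi>)) \<le> num_weights \<Phi>"
proof (induction \<Phi>)
  case Nil
  then show ?case by (simp add: weights_of_def num_weights_def)
next
  case (Cons p \<Phi>)
  let ?A = "{(i, j). i < dim_row (fst p) \<and> j < dim_col (fst p) \<and> fst p $$ (i, j) \<noteq> 0}"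
  let ?B = "{i. i < dim_vec (snd p) \<and> vec_index (snd p) i \<noteq> 0}"
  have fin: "finite ?A" "finite ?B"
    by (rule finite_subset[of _ "{..<dim_row (fst p)} \<times> {..<dim_col (fst p)}"]) auto
  have "card (supp (weights_of (p # \<Phi>))) \<le> card ?A + card ?B + card (supp (weights_of \<Phi>))"
    unfolding supp_weights_of_Cons
    by (intro order_trans[OF card_Un_le] add_mono card_image_le fin conjunct1[OF Cons.IH])
  also have "\<dots> \<le> num_weights (p # \<Phi>)"
    using Cons.IH by (simp add: num_weights_def case_prod_beta)
  finally show ?case using fin Cons.IH unfolding supp_weights_of_Cons by blast
qed

lemma norm_weights_of_le:
  assumes "weights_bounded K \<Phi>" "0 \<le> K"
  shows "cmod (weights_of \<Phi> t) \<le> K"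
proof -
  have "cmod (weights_of \<Phi> (l, i, j)) \<le> K" for l i j
  proof (cases "l < length \<Phi>")
    case True
    then have "\<Phi> ! l \<in> set \<Phi>" by simp
    with assms True show ?thesis
      by (cases j) (auto simp: weights_bounded_def weights_of_def case_prod_beta)
  qed (use assms in \<open>simp add: weights_of_def\<close>)
  then show ?thesis by (cases t) auto
qed

text \<open>The realization of a network recurses from the front, passing on the values after the first layer,
  whereas \<^const>\<open>hidden\<close> recurses from the back. This lemma translates between the two.\<close>
lemma hidden_Cons:
  "hidden R (weights_of (p # \<Phi>)) x (Suc l) i =
   hidden R (weights_of \<Phi>) (hidden R (weights_of (p # \<Phi>)) x 1) l i"
proof (induction l arbitrary: i)
  case (Suc l)
  then show ?case
    by (simp only: hidden.simps(2)[of _ _ _ "Suc l"] hidden.simps(2)[of _ _ _ l] affine_row_def weights_of_Cons_Suc)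
qed simp

lemma net_output_Cons:
  assumes "\<Phi> \<noteq> []"
  shows "net_output R (weights_of (p # \<Phi>)) x (length (p # \<Phi>))
    = net_output R (weights_of \<Phi>) (hidden R (weights_of (p # \<Phi>)) x 1) (length \<Phi>)"
proof -
  obtain k where k: "length \<Phi> = Suc k" using assms by (cases \<Phi>) auto
  show ?thesis
    by (simp only: k length_Cons net_output_def diff_Suc_1 affine_row_def hidden_Cons weights_of_Cons_Suc)
qed

lemma affine_row_weights_of:
  assumes "\<Phi> = p # \<Phi>'" "fst p \<in> carrier_mat r c" "snd p \<in> carrier_vec r" "c \<le> R" "i < r"
    and "\<And>j. j < c \<Longrightarrow> x j = vec_index v j" "v \<in> carrier_vec c"
  shows "affine_row R (weights_of \<Phi>) 0 x i = vec_index (fst p *\<^sub>v v + snd p) i"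
proof -
  have "(\<Sum>j<R. weights_of \<Phi> (0, i, Suc j) * x j) = (\<Sum>j<c. weights_of \<Phi> (0, i, Suc j) * x j)"
    using assms by (intro sum.mono_neutral_right) (auto simp: weights_of_def)
  also have "\<dots> = (\<Sum>j<c. fst p $$ (i, j) * vec_index v j)"
    using assms by (intro sum.cong) (auto simp: weights_of_def)
  finally show ?thesis using assms
    by (auto simp: affine_row_def weights_of_def scalar_prod_def atLeast0LessThan)
qed

lemma realization_eq_net_output:
  assumes "is_network c 1 \<Phi>" "v \<in> carrier_vec c" "\<And>j. j < c \<Longrightarrow> x j = vec_index v j"
    and "\<And>p. p \<in> set \<Phi> \<Longrightarrow> dim_col (fst p) \<le> R"
  shows "vec_index (realization modReLU \<Phi> v) 0 = net_output R (weights_of \<Phi>) x (length \<Phi>)"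
  using assms
proof (induction \<Phi> arbitrary: c v x)
  case Nil
  then show ?case by (simp add: is_network_def)
next
  case (Cons p \<Phi>)
  obtain N where N: "N 0 = c" "N (Suc (length \<Phi>)) = 1" "\<And>l. l \<le> Suc (length \<Phi>) \<Longrightarrow> 0 < N l"
    "\<And>l. l < Suc (length \<Phi>) \<Longrightarrow> fst ((p # \<Phi>) ! l) \<in> carrier_mat (N (Suc l)) (N l)"
    "\<And>l. l < Suc (length \<Phi>) \<Longrightarrow> snd ((p # \<Phi>) ! l) \<in> carrier_vec (N (Suc l))"
    using Cons.prems(1) unfolding is_network_def by auto
  have p: "fst p \<in> carrier_mat (N 1) c" "snd p \<in> carrier_vec (N 1)" using N(1) N(4,5)[of 0] by auto
  have cR: "c \<le> R" using Cons.prems(4)[of p] p by auto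
  have row: "affine_row R (weights_of (p # \<Phi>)) 0 x i = vec_index (fst p *\<^sub>v v + snd p) i" if "i < N 1" for i
    by (rule affine_row_weights_of[OF refl p cR that Cons.prems(3,2)])
  show ?case
  proof (cases "\<Phi> = []")
    case True
    then have "N 1 = 1" using N(2) by simp
    then have "affine_row R (weights_of (p # \<Phi>)) 0 x 0 = vec_index (fst p *\<^sub>v v + snd p) 0"
      using row[of 0] by simp
    moreover have "hidden R (weights_of (p # \<Phi>)) x 0 = x" by (simp add: fun_eq_iff)
    ultimately show ?thesis using True by (cases p) (simp add: net_output_def)
  next
    case False
    let ?v = "map_vec modReLU (fst p *\<^sub>v v + snd p)"
    let ?x = "hidden R (weights_of (p # \<Phi>)) x 1"
    have net: "is_network (N 1) 1 \<Phi>"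
      unfolding is_network_def using False N(2,3) N(4,5)[of "Suc _"]
      by (intro conjI exI[of _ "\<lambda>l. N (Suc l)"]) auto
    have v: "?v \<in> carrier_vec (N 1)"
      using p Cons.prems(2) by (metis add_carrier_vec mult_mat_vec_carrier map_carrier_vec)
    have h0: "hidden R (weights_of (p # \<Phi>)) x 0 = x" by (simp add: fun_eq_iff)
    have x: "?x j = vec_index ?v j" if "j < N 1" for j
      using row[OF that] p that by (simp add: h0)
    have "vec_index (realization modReLU (p # \<Phi>) v) 0 = vec_index (realization modReLU \<Phi> ?v) 0"
      using False by (cases \<Phi>; cases p) auto
    also have "\<dots> = net_output R (weights_of \<Phi>) ?x (length \<Phi>)"
      by (rule Cons.IH[OF net v x]) (use Cons.prems(4) in auto)
    also have "\<dots> = net_output R (weights_of (p # \<Phi>)) x (length (p # \<Phi>))"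
      by (rule net_output_Cons[OF False, symmetric])
    finally show ?thesis .
  qed
qed

section \<open>Removing dead neurons\<close>

text \<open>Summands with \<open>v j = 0\<close> can be dropped, and the remaining indices renumbered.\<close>
lemma affine_row_reindex:
  assumes "bij_betw r {..<m} (Act :: nat set)" "Act \<subseteq> {..<R}" "m \<le> R'"
    and "\<And>j. j < R \<Longrightarrow> j \<notin> Act \<Longrightarrow> v j = 0"
    and "\<And>j. j < m \<Longrightarrow> v' j = v (r j)"
    and "\<theta>' (l, i', 0) = \<theta> (l, i, 0)"
    and "\<And>j. \<theta>' (l, i', Suc j) = (if j < m then \<theta> (l, i, Suc (r j)) else 0)"
  shows "affine_row R' \<theta>' l v' i' = affine_row R \<theta> l v i"
proof -
  have "(\<Sum>j<R'. \<theta>' (l, i', Suc j) * v' j) = (\<Sum>j<m. \<theta> (l, i, Suc (r j)) * v (r j))"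
    using assms(3,5,7) by (intro sum.mono_neutral_cong_right) auto
  also have "\<dots> = (\<Sum>j\<in>Act. \<theta> (l, i, Suc j) * v j)"
    by (rule sum.reindex_bij_betw[OF assms(1)])
  also have "\<dots> = (\<Sum>j<R. \<theta> (l, i, Suc j) * v j)"
    using assms(2,4) by (intro sum.mono_neutral_left) auto
  finally show ?thesis using assms(6) by (simp add: affine_row_def)
qed

text \<open>A neuron of a hidden layer whose row of weights (bias included) vanishes has the value \<open>0\<close>, because
  the activation maps \<open>0\<close> to \<open>0\<close>. The other neurons of that layer number at most \<open>card (supp \<theta>)\<close>. Keeping
  only these and renumbering them consecutively confines the positions of the nonzero weights to a box
  whose size depends on \<open>L\<close>, \<open>W\<close> and \<open>d\<close> only, which is what makes networks countable in terms of
  their number of weights. Inputs and the output keep their numbers.\<close>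
lemma prune_dead_neurons:
  fixes \<theta> :: weights
  assumes fin: "finite (supp \<theta>)" and W: "card (supp \<theta>) \<le> W" and "1 \<le> L" "d \<le> R" "1 \<le> R"
  obtains \<theta>' where "finite (supp \<theta>')" "card (supp \<theta>') \<le> W"
    "supp \<theta>' \<subseteq> {..<L} \<times> {..<W + d + 1} \<times> {..W + d + 1}"
    "range \<theta>' \<subseteq> insert 0 (range \<theta>)"
    "\<forall>x. (\<forall>j\<ge>d. x j = 0) \<longrightarrow> net_output (W + d + 1) \<theta>' x L = net_output R \<theta> x L"
proof -
  define Act where "Act l = (if l = 0 then {..<d} else if l = L then {0}
    else {i. i < R \<and> (\<exists>j. \<theta> (l - 1, i, j) \<noteq> 0)})" for l
  define m where "m l = card (Act l)" for l
  have finAct: "finite (Act l)" for l by (simp add: Act_def)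
  have ActR: "Act l \<subseteq> {..<R}" for l using assms by (auto simp: Act_def)
  have m0: "m 0 = d" by (simp add: m_def Act_def)
  have mL: "m L = 1" using \<open>1 \<le> L\<close> by (simp add: m_def Act_def)
  have mW: "m l \<le> W" if "l \<noteq> 0" "l \<noteq> L" for l
  proof -
    have "Act l \<subseteq> (\<lambda>(l, i, j). i) ` supp \<theta>" using that by (force simp: Act_def)
    then have "m l \<le> card (supp \<theta>)"
      unfolding m_def using surj_card_le[OF fin] by blast
    with W show ?thesis by simp
  qed
  have mR: "m l \<le> W + d + 1" for l
    using m0 mL mW[of l] by (cases "l = 0 \<or> l = L") auto
  have "\<exists>r. bij_betw r {..<m l} (Act l) \<and> (l = 0 \<longrightarrow> r = id)" for l
  proof (cases "l = 0")
    case True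
    then show ?thesis by (intro exI[of _ id]) (simp add: m_def Act_def)
  next
    case False
    then show ?thesis using ex_bij_betw_nat_finite[OF finAct[of l]] by (auto simp: m_def atLeast0LessThan)
  qed
  then obtain r where r: "\<And>l. bij_betw (r l) {..<m l} (Act l)" and r0: "r 0 = id" by metis
  have rL: "r L 0 = 0"
    using bij_betwE[OF r[of L]] mL \<open>1 \<le> L\<close> by (auto simp: Act_def)
  \<comment> \<open>Positions of the new weights are mapped back to the original ones; \<open>m l\<close> neurons of layer \<open>l\<close>
    survive, and \<open>r l\<close> enumerates them.\<close>
  define old where "old = (\<lambda>(l, i, j). (l :: nat, r (Suc l) i, case j of 0 \<Rightarrow> 0 | Suc j \<Rightarrow> Suc (r l j)))"
  define \<theta>' where "\<theta>' = (\<lambda>(l, i, j).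
     if l < L \<and> i < m (Suc l) \<and> (case j of 0 \<Rightarrow> True | Suc j \<Rightarrow> j < m l) then \<theta> (old (l, i, j)) else 0)"
  have supp: "supp \<theta>' \<subseteq> {(l, i, j). l < L \<and> i < m (Suc l) \<and> (case j of 0 \<Rightarrow> True | Suc j \<Rightarrow> j < m l)}"
    by (auto simp: \<theta>'_def split: if_splits)
  have inj: "inj_on old (supp \<theta>')"
  proof (rule inj_onI)
    fix s t assume st: "s \<in> supp \<theta>'" "t \<in> supp \<theta>'" "old s = old t"
    obtain l i j l' i' j' where eq: "s = (l, i, j)" "t = (l', i', j')" by (cases s; cases t)
    have *: "i < m (Suc l)" "case j of 0 \<Rightarrow> True | Suc j \<Rightarrow> j < m l"
      "i' < m (Suc l')" "case j' of 0 \<Rightarrow> True | Suc j \<Rightarrow> j < m l'" "old (l, i, j) = old (l', i', j')"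
      using st supp unfolding eq by auto
    have ll: "l' = l" using * by (simp add: old_def)
    have "i = i'" using * bij_betw_imp_inj_on[OF r[of "Suc l"]] by (auto simp: old_def ll inj_on_def)
    moreover have "j = j'" using * bij_betw_imp_inj_on[OF r[of l]]
      by (auto simp: old_def ll inj_on_def split: nat.splits)
    ultimately show "s = t" using ll eq by simp
  qed
  have img: "old ` supp \<theta>' \<subseteq> supp \<theta>"
    by (auto simp: \<theta>'_def split: if_splits)
  have fin': "finite (supp \<theta>')" by (rule inj_on_finite[OF inj img fin])
  have card': "card (supp \<theta>') \<le> W" using card_inj_on_le[OF inj img fin] W by simp
  have box: "supp \<theta>' \<subseteq> {..<L} \<times> {..<W + d + 1} \<times> {..W + d + 1}"
  proof
    fix t assume "t \<in> supp \<theta>'"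
    moreover obtain l i j where t: "t = (l, i, j)" by (cases t)
    ultimately have "l < L" "i < m (Suc l)" "j = 0 \<or> j - 1 < m l"
      by (auto simp: \<theta>'_def split: if_splits nat.splits)
    with t mR[of "Suc l"] mR[of l] show "t \<in> {..<L} \<times> {..<W + d + 1} \<times> {..W + d + 1}" by auto
  qed
  have row: "affine_row (W + d + 1) \<theta>' l v' i = affine_row R \<theta> l v (r (Suc l) i)"
    if "l < L" "i < m (Suc l)" "\<And>j. j < R \<Longrightarrow> j \<notin> Act l \<Longrightarrow> v j = 0"
      "\<And>j. j < m l \<Longrightarrow> v' j = v (r l j)" for l i v v'
    by (rule affine_row_reindex[where r = "r l" and m = "m l" and Act = "Act l"])
      (use that r ActR mR in \<open>simp_all add: \<theta>'_def old_def\<close>)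
  have out: "net_output (W + d + 1) \<theta>' x L = net_output R \<theta> x L" if x: "\<And>j. d \<le> j \<Longrightarrow> x j = 0" for x
  proof -
    have hid: "(\<forall>i<m l. hidden (W + d + 1) \<theta>' x l i = hidden R \<theta> x l (r l i)) \<and>
        (\<forall>i<R. i \<notin> Act l \<longrightarrow> hidden R \<theta> x l i = 0)" if "l < L" for l
      using that
    proof (induction l)
      case 0
      then show ?case using x by (auto simp: r0 Act_def)
    next
      case (Suc l)
      have "hidden R \<theta> x (Suc l) i = 0" if "i < R" "i \<notin> Act (Suc l)" for i
      proof -
        have "\<theta> (l, i, j) = 0" for j using that Suc.prems by (auto simp: Act_def)
        then show ?thesis by (simp add: affine_row_def)
      qed
      moreover have "hidden (W + d + 1) \<theta>' x (Suc l) i = hidden R \<theta> x (Suc l) (r (Suc l) i)"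
        if "i < m (Suc l)" for i
        using row[of l i "hidden R \<theta> x l" "hidden (W + d + 1) \<theta>' x l"] that Suc by simp
      ultimately show ?case by blast
    qed
    have "L - 1 < L" "Suc (L - 1) = L" using \<open>1 \<le> L\<close> by auto
    then show ?thesis
      using row[of "L - 1" 0 "hidden R \<theta> x (L - 1)" "hidden (W + d + 1) \<theta>' x (L - 1)"] hid[of "L - 1"]
      by (simp add: net_output_def rL mL)
  qed
  have "range \<theta>' \<subseteq> insert 0 (range \<theta>)" by (auto simp: \<theta>'_def)
  with fin' card' box out show ?thesis by (intro that) auto
qed

section \<open>Perturbation of the weights\<close>

text \<open>From \<open>\<theta> v - \<theta>' v' = (\<theta> - \<theta>') v + \<theta>' (v - v')\<close>, term by term. The factor \<open>real R + 1\<close> in front of \<open>e\<close>, where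
  \<open>real R\<close> would do, makes one growth factor per layer serve both the values and the errors.\<close>
lemma affine_row_perturb:
  assumes "\<And>t. cmod (\<theta>' t) \<le> K" "\<And>t. cmod (\<theta> t - \<theta>' t) \<le> \<delta>" "0 \<le> \<delta>" "1 \<le> B" "0 \<le> e" "0 \<le> K"
    and "\<And>j. j < R \<Longrightarrow> cmod (v j) \<le> B" "\<And>j. j < R \<Longrightarrow> cmod (v j - v' j) \<le> e"
  shows "cmod (affine_row R \<theta> l v i - affine_row R \<theta>' l v' i) \<le> \<delta> * ((real R + 1) * B) + K * (real R + 1) * e"
proof -
  have "affine_row R \<theta> l v i - affine_row R \<theta>' l v' i = (\<theta> (l, i, 0) - \<theta>' (l, i, 0))
      + (\<Sum>j<R. (\<theta> (l, i, Suc j) - \<theta>' (l, i, Suc j)) * v j + \<theta>' (l, i, Suc j) * (v j - v' j))"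
    by (simp add: affine_row_def algebra_simps sum_subtractf sum.distrib)
  also have "cmod \<dots> \<le> \<delta> + (\<Sum>j<R. \<delta> * B + K * e)"
    using assms by (intro order_trans[OF norm_triangle_ineq] add_mono order_trans[OF norm_sum] sum_mono)
      (auto simp: norm_mult intro!: mult_mono)
  also have "\<dots> = \<delta> * (1 + R * B) + K * R * e" by (simp add: algebra_simps)
  also have "\<dots> \<le> \<delta> * ((real R + 1) * B) + K * (real R + 1) * e"
    using assms by (intro add_mono mult_left_mono mult_right_mono) (auto simp: algebra_simps)
  finally show ?thesis .
qed

lemma affine_row_bound:
  assumes "\<And>t. cmod (\<theta> t) \<le> K" "1 \<le> B" "0 \<le> K" "\<And>j. j < R \<Longrightarrow> cmod (v j) \<le> B"
  shows "cmod (affine_row R \<theta> l v i) \<le> K * (real R + 1) * B"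
proof -
  have "cmod (affine_row R \<theta> l v i) \<le> K + (\<Sum>j<R. K * B)"
    unfolding affine_row_def using assms
    by (intro order_trans[OF norm_triangle_ineq] add_mono order_trans[OF norm_sum] sum_mono)
      (auto simp: norm_mult intro!: mult_mono)
  also have "\<dots> \<le> K * B + (\<Sum>j<R. K * B)"
    using mult_left_mono[OF assms(2,3)] by simp
  also have "\<dots> = K * (real R + 1) * B" by (simp add: algebra_simps)
  finally show ?thesis .
qed

lemma hidden_bound:
  assumes K: "\<And>t. cmod (\<theta> t) \<le> K" "1 \<le> K" and x: "\<And>j. cmod (x j) \<le> 2"
  shows "cmod (hidden R \<theta> x l i) \<le> 2 * (K * (real R + 1)) ^ l"
proof (induction l arbitrary: i)
  case (Suc l)
  have "1 \<le> K * (real R + 1)" using mult_mono[of 1 K 1 "real R + 1"] K by simp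
  from one_le_power[OF this, of l] have "1 \<le> 2 * (K * (real R + 1)) ^ l" by linarith
  then have "cmod (affine_row R \<theta> l (hidden R \<theta> x l) i) \<le> K * (real R + 1) * (2 * (K * (real R + 1)) ^ l)"
    using K Suc by (intro affine_row_bound) auto
  then show ?case
    using order_trans[OF norm_modReLU_le] by (simp add: mult.assoc mult.left_commute)
qed (use x in simp)

text \<open>Each layer multiplies the accumulated error by at most \<open>q\<close> and adds a new error of at most
  \<open>\<delta> (R + 1)\<close> times the bound \<open>2 q ^ l\<close> on the values of that layer; as the activation is nonexpansive,
  it does not enlarge the error. Since both parts scale like \<open>q ^ l\<close>, the errors add up to a factor that
  is only linear in the number of layers.\<close>
lemma affine_row_hidden_perturb:
  fixes R l i :: nat
  assumes K: "\<And>t. cmod (\<theta> t) \<le> K" "\<And>t. cmod (\<theta>' t) \<le> K" "1 \<le> K"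
    and \<delta>: "\<And>t. cmod (\<theta> t - \<theta>' t) \<le> \<delta>" "0 \<le> \<delta>" and x: "\<And>j. cmod (x j) \<le> 2"
  defines "q \<equiv> K * (real R + 1)"
  shows "cmod (affine_row R \<theta> l (hidden R \<theta> x l) i - affine_row R \<theta>' l (hidden R \<theta>' x l) i)
      \<le> 2 * \<delta> * real (Suc l) * q ^ Suc l"
proof -
  have q: "1 \<le> q" "real R + 1 \<le> q"
    using mult_mono[of 1 K 1 "real R + 1"] mult_mono[of 1 K "real R + 1" "real R + 1"] K(3) by (simp_all add: q_def)
  have step: "cmod (affine_row R \<theta> l (hidden R \<theta> x l) i - affine_row R \<theta>' l (hidden R \<theta>' x l) i)
      \<le> 2 * \<delta> * real (Suc l) * q ^ Suc l"
    if *: "\<And>i. cmod (hidden R \<theta> x l i - hidden R \<theta>' x l i) \<le> 2 * \<delta> * real l * q ^ l" for l i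
  proof -
    have "1 \<le> 2 * q ^ l" using one_le_power[OF q(1), of l] by simp
    then have "cmod (affine_row R \<theta> l (hidden R \<theta> x l) i - affine_row R \<theta>' l (hidden R \<theta>' x l) i)
        \<le> \<delta> * ((real R + 1) * (2 * q ^ l)) + K * (real R + 1) * (2 * \<delta> * real l * q ^ l)"
      using K \<delta> q * hidden_bound[of \<theta> K x R l, OF K(1,3) x]
      by (intro affine_row_perturb) (auto simp: q_def)
    also have "\<dots> \<le> \<delta> * (q * (2 * q ^ l)) + q * (2 * \<delta> * real l * q ^ l)"
      using q \<delta> by (intro add_mono mult_left_mono mult_right_mono) (auto simp: q_def)
    also have "\<dots> = 2 * \<delta> * real (Suc l) * q ^ Suc l" by (simp add: algebra_simps)
    finally show ?thesis .
  qed
  have main: "cmod (hidden R \<theta> x l i - hidden R \<theta>' x l i) \<le> 2 * \<delta> * real l * q ^ l" for l i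
  proof (induction l arbitrary: i)
    case (Suc l)
    then show ?case using order_trans[OF modReLU_nonexpansive step[of l i]] by simp
  qed simp
  show "cmod (affine_row R \<theta> l (hidden R \<theta> x l) i - affine_row R \<theta>' l (hidden R \<theta>' x l) i)
      \<le> 2 * \<delta> * real (Suc l) * q ^ Suc l" by (rule step[OF main])
qed

lemma net_output_perturb:
  assumes "\<And>t. cmod (\<theta> t) \<le> K" "\<And>t. cmod (\<theta>' t) \<le> K" "1 \<le> K"
    and "\<And>t. cmod (\<theta> t - \<theta>' t) \<le> \<delta>" "0 \<le> \<delta>" "\<And>j. cmod (x j) \<le> 2" "1 \<le> L"
  shows "cmod (net_output R \<theta> x L - net_output R \<theta>' x L) \<le> 2 * \<delta> * real L * (K * (real R + 1)) ^ L"
proof -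
  have L: "Suc (L - 1) = L" using assms(7) by simp
  show ?thesis
    using affine_row_hidden_perturb[of \<theta> K \<theta>' \<delta> x R "L - 1" 0, OF assms(1-6)] unfolding net_output_def L .
qed

section \<open>Counting rounded networks\<close>

text \<open>Rounding down to a multiple of \<open>\<tau>\<close>, so that \<open>0\<close> is fixed and sparsity survives.\<close>
definition grid_round :: "real \<Rightarrow> complex \<Rightarrow> complex" where
  "grid_round \<tau> z = Complex (\<tau> * of_int \<lfloor>Re z / \<tau>\<rfloor>) (\<tau> * of_int \<lfloor>Im z / \<tau>\<rfloor>)"

lemma grid_round_zero [simp]: "grid_round \<tau> 0 = 0"
  by (simp add: grid_round_def complex_eq_iff)

lemma grid_round_dist:
  assumes "0 < \<tau>"
  shows "cmod (z - grid_round \<tau> z) \<le> 2 * \<tau>"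
proof -
  have "\<bar>t - \<tau> * of_int \<lfloor>t / \<tau>\<rfloor>\<bar> \<le> \<tau>" for t :: real
  proof -
    have "\<tau> * of_int \<lfloor>t / \<tau>\<rfloor> \<le> \<tau> * (t / \<tau>)" "\<tau> * (t / \<tau>) \<le> \<tau> * (of_int \<lfloor>t / \<tau>\<rfloor> + 1)"
      using assms by (intro mult_left_mono; linarith)+
    with assms show ?thesis by (simp add: algebra_simps abs_le_iff)
  qed
  from this[of "Re z"] this[of "Im z"] cmod_le[of "z - grid_round \<tau> z"] show ?thesis
    by (simp add: grid_round_def)
qed

lemma card_grid_round:
  assumes "0 < \<tau>" "0 \<le> K"
  obtains Y where "finite Y" "real (card Y) \<le> (2 * K / \<tau> + 3)\<^sup>2" "\<And>z. cmod z \<le> K \<Longrightarrow> grid_round \<tau> z \<in> Y"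
proof -
  define V where "V = \<lceil>K / \<tau>\<rceil>"
  define Y where "Y = (\<lambda>(a, b). Complex (\<tau> * of_int a) (\<tau> * of_int b)) ` ({-V..V} \<times> {-V..V})"
  have V: "0 \<le> V" "real_of_int V \<le> K / \<tau> + 1"
  proof -
    have "0 \<le> K / \<tau>" using assms by simp
    then show "0 \<le> V" "real_of_int V \<le> K / \<tau> + 1" unfolding V_def by linarith+
  qed
  have "card Y \<le> card ({-V..V} \<times> {-V..V})" unfolding Y_def by (intro card_image_le) auto
  also have "\<dots> = (nat (2 * V + 1))\<^sup>2" by (simp add: card_cartesian_product power2_eq_square)
  finally have "real (card Y) \<le> real ((nat (2 * V + 1))\<^sup>2)" by (rule of_nat_mono)
  also have "\<dots> = (2 * real_of_int V + 1)\<^sup>2" using V(1) by simp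
  also have "\<dots> \<le> (2 * K / \<tau> + 3)\<^sup>2" using V by (intro power_mono) auto
  finally have card: "real (card Y) \<le> (2 * K / \<tau> + 3)\<^sup>2" .
  have "\<lfloor>t / \<tau>\<rfloor> \<in> {-V..V}" if "\<bar>t\<bar> \<le> K" for t :: real
  proof -
    have "- (K / \<tau>) \<le> t / \<tau>" "t / \<tau> \<le> K / \<tau>"
      using that assms by (auto simp: field_simps abs_le_iff)
    then show ?thesis unfolding V_def by simp linarith
  qed
  then have "grid_round \<tau> z \<in> Y" if "cmod z \<le> K" for z
    using that abs_Re_le_cmod[of z] abs_Im_le_cmod[of z]
    unfolding grid_round_def Y_def by (intro image_eqI[of _ _ "(\<lfloor>Re z / \<tau>\<rfloor>, \<lfloor>Im z / \<tau>\<rfloor>)"]) auto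
  moreover have "finite Y" by (simp add: Y_def)
  ultimately show ?thesis using card by (intro that)
qed

lemma sum_powers_le: "(\<Sum>i\<le>n. c ^ i) \<le> (c + 1) ^ n" for c :: nat
proof (induction n)
  case (Suc n)
  have "(\<Sum>i\<le>Suc n. c ^ i) = 1 + c * (\<Sum>i\<le>n. c ^ i)"
    by (simp add: sum.atMost_Suc_shift sum_distrib_left del: sum.atMost_Suc)
  also have "\<dots> \<le> (c + 1) ^ n + c * (c + 1) ^ n"
    using Suc by (intro add_mono mult_left_mono) auto
  finally show ?case by (simp add: algebra_simps)
qed simp

text \<open>A function with at most \<open>W\<close> nonzero values is determined by the list of its at most \<open>W\<close> arguments
  and values, and there are \<open>\<Sum>i\<le>W. c ^ i \<le> (c + 1) ^ W\<close> lists of length at most \<open>W\<close> over an alphabet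
  of size \<open>c\<close>. The exponent \<open>W\<close>, instead of the size of \<open>X\<close>, is what brings the number of weights
  into the final estimate.\<close>
lemma card_sparse_functions:
  fixes X :: "'a set" and Y :: "'b::zero set" and W :: nat
  assumes "finite X" "finite Y"
  defines "F \<equiv> {f. supp f \<subseteq> X \<and> card (supp f) \<le> W \<and> range f \<subseteq> insert 0 Y}"
  shows "finite F" "card F \<le> (card X * card Y + 1) ^ W"
proof -
  define D where "D = {xs. set xs \<subseteq> X \<times> Y \<and> length xs \<le> W}"
  define dec where "dec xs = (\<lambda>a. case map_of xs a of None \<Rightarrow> 0 | Some b \<Rightarrow> b)" for xs :: "('a \<times> 'b) list"
  have finD: "finite D" unfolding D_def using assms by (intro finite_lists_length_le) auto
  have "F \<subseteq> dec ` D"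
  proof
    fix f assume f: "f \<in> F"
    have "finite (supp f)" using f assms by (auto simp: F_def intro: finite_subset)
    then obtain as where as: "set as = supp f" "distinct as" using finite_distinct_list by blast
    let ?xs = "map (\<lambda>a. (a, f a)) as"
    have "length as \<le> W" using f as distinct_card[OF as(2)] by (simp add: F_def)
    moreover have "f a \<in> Y" if "f a \<noteq> 0" for a using f that rangeI[of f a] by (auto simp: F_def)
    ultimately have "?xs \<in> D" using f as by (auto simp: D_def F_def)
    moreover have "dec ?xs = f"
      using as(1) by (auto simp: dec_def fun_eq_iff map_of_map_restrict restrict_map_def)
    ultimately show "f \<in> dec ` D" by (metis imageI)
  qed
  then show "finite F" "card F \<le> (card X * card Y + 1) ^ W"
  proof -
    assume *: "F \<subseteq> dec ` D"
    then show "finite F" using finD finite_subset by blast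
    have "card F \<le> card D" by (rule surj_card_le[OF finD *])
    also have "\<dots> = (\<Sum>i\<le>W. card (X \<times> Y) ^ i)"
      unfolding D_def using assms by (intro card_lists_length_le) auto
    also have "\<dots> \<le> (card X * card Y + 1) ^ W"
      using sum_powers_le by (simp add: card_cartesian_product)
    finally show "card F \<le> (card X * card Y + 1) ^ W" .
  qed
qed

lemma norm_coord_vec_le:
  fixes z :: "complex ^ 'd"
  assumes "z \<in> complex_cube" "j < CARD('d)"
  shows "cmod (vec_index (coord_vec z) j) \<le> 2"
proof -
  let ?w = "vec_nth z (from_nat_into UNIV j)"
  have "0 \<le> Re ?w" "Re ?w \<le> 1" "0 \<le> Im ?w" "Im ?w \<le> 1" using assms by (auto simp: complex_cube_def)
  then have "cmod ?w \<le> 2" using cmod_le[of ?w] by linarith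
  with assms show ?thesis by (simp add: coord_vec_def)
qed

text \<open>The network may be arbitrarily wide compared with its number of weights; pruning is what confines the
  positions of the nonzero weights to a box that depends on \<open>L\<close>, \<open>W\<close> and the input dimension only.\<close>
lemma implements_imp_sparse_output:
  fixes f :: "complex ^ 'd \<Rightarrow> complex"
  assumes "implements \<Phi> f" "length \<Phi> \<le> L" "num_weights \<Phi> \<le> W" "weights_bounded K \<Phi>" "0 \<le> K"
  obtains \<theta> l where "l \<in> {1..L}" "finite (supp \<theta>)" "card (supp \<theta>) \<le> W"
    "supp \<theta> \<subseteq> {..<L} \<times> {..<W + CARD('d) + 1} \<times> {..W + CARD('d) + 1}" "\<And>t. cmod (\<theta> t) \<le> K"
    "\<And>z. f z = net_output (W + CARD('d) + 1) \<theta>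
       (\<lambda>j. if j < CARD('d) then vec_index (coord_vec z) j else 0) l"
proof -
  let ?d = "CARD('d)"
  let ?x = "\<lambda>z :: complex ^ 'd. \<lambda>j. if j < ?d then vec_index (coord_vec z) j else 0"
  have net: "is_network ?d 1 \<Phi>" and real: "realization modReLU \<Phi> (coord_vec z) = Matrix.vec 1 (\<lambda>_. f z)" for z
    using assms(1) by (auto simp: implements_def)
  define R where "R = ?d + (\<Sum>p\<leftarrow>\<Phi>. dim_col (fst p))"
  have R: "dim_col (fst p) \<le> R" if "p \<in> set \<Phi>" for p
    using member_le_sum_list[of "dim_col (fst p)" "map (\<lambda>p. dim_col (fst p)) \<Phi>"] that by (auto simp: R_def)
  have L: "1 \<le> length \<Phi>" using net by (cases \<Phi>) (auto simp: is_network_def)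
  have fin: "finite (supp (weights_of \<Phi>))" and card: "card (supp (weights_of \<Phi>)) \<le> W"
    using card_supp_weights_of[of \<Phi>] assms(3) by auto
  have dR: "?d \<le> R" and R1: "1 \<le> R" by (simp_all add: R_def Suc_leI)
  obtain \<theta> where \<theta>: "finite (supp \<theta>)" "card (supp \<theta>) \<le> W"
    "supp \<theta> \<subseteq> {..<length \<Phi>} \<times> {..<W + ?d + 1} \<times> {..W + ?d + 1}"
    "range \<theta> \<subseteq> insert 0 (range (weights_of \<Phi>))"
    "\<forall>x. (\<forall>j\<ge>?d. x j = 0) \<longrightarrow>
      net_output (W + ?d + 1) \<theta> x (length \<Phi>) = net_output R (weights_of \<Phi>) x (length \<Phi>)"
    by (rule prune_dead_neurons[OF fin card L dR R1], rule that)
  have "f z = net_output (W + ?d + 1) \<theta> (?x z) (length \<Phi>)" for z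
  proof -
    have "f z = vec_index (realization modReLU \<Phi> (coord_vec z)) 0" by (simp add: real)
    also have "\<dots> = net_output R (weights_of \<Phi>) (?x z) (length \<Phi>)"
      by (rule realization_eq_net_output[OF net _ _ R]) (auto simp: coord_vec_def)
    also have "\<dots> = net_output (W + ?d + 1) \<theta> (?x z) (length \<Phi>)"
      by (rule \<theta>(5)[rule_format, symmetric]) simp
    finally show ?thesis .
  qed
  moreover have "cmod (\<theta> t) \<le> K" for t
    using \<theta>(4) norm_weights_of_le[OF assms(4,5)] \<open>0 \<le> K\<close> by (metis UNIV_I image_subset_iff insertE norm_zero rangeE)
  moreover have "supp \<theta> \<subseteq> {..<L} \<times> {..<W + ?d + 1} \<times> {..W + ?d + 1}"
    by (rule order_trans[OF \<theta>(3)]) (use assms(2) in auto)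
  ultimately show ?thesis using \<theta>(1,2) L assms(2) by (intro that[of "length \<Phi>" \<theta>]) auto
qed

text \<open>The upper count: after pruning and rounding, a network is one of the sparse functions counted in
  \<open>card_sparse_functions\<close>. A single base \<open>P\<close>, large enough to dominate every quantity involved, keeps
  the bound in closed form; its logarithm is of order \<open>L * W\<close> up to the factor \<open>ln P\<close>. The
  covering functions approximate on the whole cube, not merely almost everywhere.\<close>
lemma network_covering:
  fixes L W :: nat and K \<delta> :: real
  assumes "1 \<le> K" "0 < \<delta>" "\<delta> \<le> 1"
  defines "P \<equiv> 16 * (real L + 1) * (real W + real CARD('d) + 2) * (K + 1) / \<delta>"
  obtains G :: "(complex ^ 'd \<Rightarrow> complex) set" where
    "finite G" "real (card G) \<le> P ^ ((2 * L + 6) * (W + 1))"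
    "\<forall>\<Phi> f. implements \<Phi> f \<and> length \<Phi> \<le> L \<and> num_weights \<Phi> \<le> W \<and> weights_bounded K \<Phi> \<longrightarrow>
       (\<exists>g\<in>G. \<forall>z\<in>complex_cube. cmod (f z - g z) \<le> \<delta>)"
proof (cases "L = 0")
  case True
  have "\<not> implements \<Phi> f" if "length \<Phi> \<le> L" for \<Phi> and f :: "complex ^ 'd \<Rightarrow> complex"
    using that True by (auto simp: implements_def is_network_def)
  with assms(1-3) show ?thesis by (intro that[of "{}"]) (auto simp: P_def)
next
  case False
  define R where "R = W + CARD('d) + 1"
  define q where "q = (K + 1) * (real R + 1)"
  \<comment> \<open>Rounded weights are bounded by \<open>K + 1\<close>, and rounding changes a weight by at most \<open>2 * \<tau>\<close>; the
    choice of \<open>\<tau>\<close> makes the resulting bound on the change of the output equal to \<open>\<delta>\<close>.\<close>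
  define \<tau> where "\<tau> = \<delta> / (4 * real L * q ^ L)"
  have L: "1 \<le> real L" using False by simp
  have q: "1 \<le> q" using mult_mono[of 1 "K + 1" 1 "real R + 1"] assms(1-3) by (simp add: q_def)
  have qL: "1 \<le> q ^ L" using q by simp
  have den: "4 \<le> 4 * real L * q ^ L" using mult_mono[of 1 "real L" 1 "q ^ L"] L qL by simp
  have \<tau>: "0 < \<tau>" "2 * \<tau> \<le> 1" "2 * (2 * \<tau>) * real L * q ^ L = \<delta>"
  proof -
    show "0 < \<tau>" using den assms(1-3) by (simp add: \<tau>_def)
    have "\<tau> \<le> 1 / 4" unfolding \<tau>_def using den assms(1-3) by (intro frac_le) auto
    then show "2 * \<tau> \<le> 1" by simp
    show "2 * (2 * \<tau>) * real L * q ^ L = \<delta>" using L q by (simp add: \<tau>_def)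
  qed
  obtain Y where Y: "finite Y" "real (card Y) \<le> (2 * K / \<tau> + 3)\<^sup>2" "\<And>z. cmod z \<le> K \<Longrightarrow> grid_round \<tau> z \<in> Y"
    using card_grid_round[OF \<tau>(1), of K] assms(1-3) by auto
  define X where "X = {..<L} \<times> {..<R} \<times> {..R}"
  define F where "F = {\<theta> :: weights. supp \<theta> \<subseteq> X \<and> card (supp \<theta>) \<le> W \<and> range \<theta> \<subseteq> insert 0 Y}"
  define x where "x z = (\<lambda>j. if j < CARD('d) then vec_index (coord_vec z) j else 0)" for z :: "complex ^ 'd"
  define G where "G = (\<lambda>(l, \<theta>). \<lambda>z. net_output R \<theta> (x z) l) ` ({1..L} \<times> F)"
  have finX: "finite X" by (simp add: X_def)
  have F: "finite F" "card F \<le> (card X * card Y + 1) ^ W"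
    unfolding F_def by (rule card_sparse_functions[OF finX Y(1)])+
  have "finite G" using F by (simp add: G_def)
  moreover have "real (card G) \<le> P ^ ((2 * L + 6) * (W + 1))"
  proof -
    have P_ge: "16 * a \<le> P" if "a \<le> (real L + 1) * (real W + real CARD('d) + 2) * (K + 1)" "0 \<le> a" for a
    proof -
      have "16 * a \<le> 16 * ((real L + 1) * (real W + real CARD('d) + 2) * (K + 1)) / 1" using that by simp
      also have "\<dots> \<le> 16 * ((real L + 1) * (real W + real CARD('d) + 2) * (K + 1)) / \<delta>"
        using assms(1-3) that by (intro divide_left_mono) auto
      finally show ?thesis by (simp only: P_def mult.assoc)
    qed
    have prod3: "a * b * c \<le> (real L + 1) * (real W + real CARD('d) + 2) * (K + 1)"
      if "a \<le> real L + 1" "b \<le> real W + real CARD('d) + 2" "c \<le> K + 1" "0 \<le> a" "0 \<le> b" "0 \<le> c" for a b c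
      using that by (intro mult_mono) auto
    have P1: "16 \<le> P" using P_ge[OF prod3[of 1 1 1]] assms(1-3) by simp
    have LP: "real L \<le> P" using P_ge[OF prod3[of "real L" 1 1]] assms(1-3) by simp
    have RP: "real R + 1 \<le> P" using P_ge[OF prod3[of 1 "real R + 1" 1]] assms(1-3) by (simp add: R_def)
    have qP: "q \<le> P"
    proof -
      have "16 * q \<le> P"
        using P_ge[OF prod3[of 1 "real R + 1" "K + 1"]] assms(1-3) by (simp add: q_def R_def mult.commute)
      with q show ?thesis by linarith
    qed
    have 1: "2 * K / \<tau> + 3 \<le> P ^ (L + 1)"
    proof -
      have "2 * K / \<tau> + 3 \<le> 2 * K / \<tau> + 3 / \<tau>" using \<tau> by (simp add: field_simps)
      also have "\<dots> = (2 * K + 3) / \<tau>" by (simp add: add_divide_distrib)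
      also have "\<dots> \<le> 4 * (K + 1) / \<tau>" using \<tau> assms(1-3) by (intro divide_right_mono) auto
      also have "\<dots> = 16 * (real L * 1 * (K + 1)) / \<delta> * q ^ L" by (simp add: \<tau>_def)
      also have "\<dots> \<le> P * P ^ L"
      proof (intro mult_mono power_mono)
        show "16 * (real L * 1 * (K + 1)) / \<delta> \<le> P"
        proof -
          have "16 * (real L * 1 * (K + 1)) \<le> 16 * ((real L + 1) * (real W + real CARD('d) + 2) * (K + 1))"
            using assms(1) by (intro mult_left_mono prod3) auto
          then have "16 * (real L * 1 * (K + 1)) / \<delta>
              \<le> 16 * ((real L + 1) * (real W + real CARD('d) + 2) * (K + 1)) / \<delta>"
            using assms(2) by (intro divide_right_mono) auto
          then show ?thesis by (simp only: P_def mult.assoc)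
        qed
      qed (use q qP P1 in auto)
      finally show ?thesis by simp
    qed
    have "0 \<le> K / \<tau>" using assms(1-3) \<tau> by simp
    then have "(2 * K / \<tau> + 3)\<^sup>2 \<le> (P ^ (L + 1))\<^sup>2" using 1 by (intro power_mono) auto
    moreover have "(P ^ (L + 1))\<^sup>2 = P ^ (2 * L + 2)"
      by (subst power_mult[symmetric]) (simp add: mult.commute)
    ultimately have cY: "real (card Y) \<le> P ^ (2 * L + 2)" using Y(2) by linarith
    have "real (card X) = real L * (real R * (real R + 1))" by (simp add: X_def card_cartesian_product algebra_simps)
    also have "\<dots> \<le> P * (P * P)" using LP RP P1 by (intro mult_mono) auto
    finally have cX: "real (card X) \<le> P ^ 3" by (simp add: power3_eq_cube)
    have "real (card X * card Y + 1) \<le> P ^ 3 * P ^ (2 * L + 2) + 1"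
      using cX cY P1 by (auto intro!: mult_mono)
    also have "\<dots> = P ^ (2 * L + 5) + 1"
    proof -
      have "3 + (2 * L + 2) = 2 * L + 5" by simp
      then show ?thesis using power_add[of P 3 "2 * L + 2"] by metis
    qed
    also have "\<dots> \<le> P * P ^ (2 * L + 5)"
    proof -
      have "1 \<le> P ^ (2 * L + 5)" using P1 by (intro one_le_power) auto
      moreover have "2 * P ^ (2 * L + 5) \<le> P * P ^ (2 * L + 5)" using P1 by (intro mult_right_mono) auto
      ultimately show ?thesis by linarith
    qed
    also have "P * P ^ (2 * L + 5) = P ^ (2 * L + 6)"
    proof -
      have "Suc (2 * L + 5) = 2 * L + 6" by simp
      then show ?thesis using power_Suc[of P "2 * L + 5"] by metis
    qed
    finally have base: "real (card X * card Y + 1) \<le> P ^ (2 * L + 6)" .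
    have "card G \<le> card ({1..L} \<times> F)" unfolding G_def using F by (intro card_image_le) simp
    also have "\<dots> \<le> L * (card X * card Y + 1) ^ W" using F by (simp add: card_cartesian_product)
    finally have "real (card G) \<le> real L * real (card X * card Y + 1) ^ W"
      by (metis of_nat_le_iff of_nat_mult of_nat_power)
    also have "\<dots> \<le> P ^ (2 * L + 6) * (P ^ (2 * L + 6)) ^ W"
    proof (intro mult_mono power_mono base)
      show "real L \<le> P ^ (2 * L + 6)" using LP P1 self_le_power[of P "2 * L + 6"] by simp
    qed (use P1 in auto)
    also have "\<dots> = P ^ ((2 * L + 6) * (W + 1))"
    proof -
      have "(2 * L + 6) * (W + 1) = (2 * L + 6) + (2 * L + 6) * W" by simp
      then show ?thesis by (metis power_add power_mult)
    qed
    finally show ?thesis .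
  qed
  moreover have "\<exists>g\<in>G. \<forall>z\<in>complex_cube. cmod (f z - g z) \<le> \<delta>"
    if net: "implements \<Phi> f" "length \<Phi> \<le> L" "num_weights \<Phi> \<le> W" "weights_bounded K \<Phi>" for \<Phi> f
  proof -
    have "0 \<le> K" using assms(1-3) by simp
    obtain \<theta> l where "l \<in> {1..L}" "finite (supp \<theta>)" "card (supp \<theta>) \<le> W"
      "supp \<theta> \<subseteq> {..<L} \<times> {..<W + CARD('d) + 1} \<times> {..W + CARD('d) + 1}" "\<And>t. cmod (\<theta> t) \<le> K"
      "\<And>z. f z = net_output (W + CARD('d) + 1) \<theta>
         (\<lambda>j. if j < CARD('d) then vec_index (coord_vec z) j else 0) l"
      by (rule implements_imp_sparse_output[OF net \<open>0 \<le> K\<close>], rule that)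
    note \<theta> = this[folded R_def, folded X_def x_def]
    define \<theta>' where "\<theta>' t = grid_round \<tau> (\<theta> t)" for t
    have sub: "supp \<theta>' \<subseteq> supp \<theta>" by (auto simp: \<theta>'_def)
    then have "card (supp \<theta>') \<le> W" using card_mono[OF \<theta>(2) sub] \<theta>(3) by simp
    then have "\<theta>' \<in> F" using sub \<theta>(4) Y(3)[OF \<theta>(5)] by (auto simp: F_def \<theta>'_def)
    then have mem: "(\<lambda>z. net_output R \<theta>' (x z) l) \<in> G" using \<theta>(1) by (auto simp: G_def)
    have dist: "cmod (\<theta> t - \<theta>' t) \<le> 2 * \<tau>" for t unfolding \<theta>'_def by (rule grid_round_dist[OF \<tau>(1)])
    have b: "cmod (\<theta> t) \<le> K + 1" "cmod (\<theta>' t) \<le> K + 1" for t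
      using \<theta>(5)[of t] dist[of t] \<tau>(2) norm_triangle_ineq2[of "\<theta>' t" "\<theta> t"] by (auto simp: norm_minus_commute)
    have "cmod (f z - net_output R \<theta>' (x z) l) \<le> \<delta>" if z: "z \<in> complex_cube" for z
    proof -
      have xb: "cmod (x z j) \<le> 2" for j using norm_coord_vec_le[OF z] by (simp add: x_def)
      have "cmod (f z - net_output R \<theta>' (x z) l) \<le> 2 * (2 * \<tau>) * real l * q ^ l"
        unfolding \<theta>(6) q_def using b dist xb \<tau>(1) \<theta>(1) assms(1-3) by (intro net_output_perturb) auto
      also have "\<dots> \<le> 2 * (2 * \<tau>) * real L * q ^ L"
        using \<theta>(1) \<tau>(1) q by (intro mult_mono power_increasing) auto
      finally show ?thesis using \<tau>(3) by simp
    qed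
    with mem show ?thesis by (intro bexI[of _ "\<lambda>z. net_output R \<theta>' (x z) l"]) auto
  qed
  ultimately show ?thesis by (intro that) blast+
qed

section \<open>A smooth bump on the real line\<close>

text \<open>Each differentiation lowers the multiplicity of a factor by at most one.\<close>
lemma power_dvd_iterated_pderiv:
  fixes q :: "'a :: idom poly"
  assumes "j \<le> m"
  shows "q ^ (m - j) dvd (pderiv ^^ j) (q ^ m)"
  using assms
proof (induction j)
  case (Suc j)
  obtain k where k: "m - j = Suc k" using Suc.prems by (metis Suc_diff_Suc Suc_le_lessD)
  then have k': "m - Suc j = k" by simp
  obtain r where "(pderiv ^^ j) (q ^ m) = q ^ Suc k * r"
    using Suc k by (auto simp: dvd_def)
  then have "(pderiv ^^ Suc j) (q ^ m) = q ^ Suc k * pderiv r + r * (Polynomial.smult (of_nat (Suc k)) (q ^ k) * pderiv q)"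
    by (simp add: pderiv_mult pderiv_power_Suc del: power_Suc)
  also have "q ^ k dvd \<dots>" by (intro dvd_add dvd_mult dvd_mult2 dvd_smult) (simp_all add: le_imp_power_dvd)
  finally show ?case by (simp only: k')
qed simp

text \<open>The bump is \<open>(4 t (1 - t)) ^ (n + 2)\<close> on the unit interval and \<open>0\<close> elsewhere. The exponent makes all
  derivatives up to order \<open>n + 1\<close> vanish at both end points, and the factor 4 makes the value at the
  midpoint \<open>1\<close>.\<close>
definition bump_poly :: "nat \<Rightarrow> real poly" where
  "bump_poly n = [:0, 4, -4:] ^ (n + 2)"

text \<open>The second argument is the order of the derivative; \<open>bump_has_derivative\<close> below justifies this.\<close>
definition bump :: "nat \<Rightarrow> nat \<Rightarrow> real \<Rightarrow> real" where
  "bump n j t = (if 0 \<le> t \<and> t \<le> 1 then poly ((pderiv ^^ j) (bump_poly n)) t else 0)"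

lemma bump_poly_boundary:
  assumes "j \<le> n + 1" "t \<in> {0, 1}"
  shows "poly ((pderiv ^^ j) (bump_poly n)) t = 0"
proof -
  have "[:0, 4, -4:] ^ (n + 2 - j) dvd (pderiv ^^ j) (bump_poly n)"
    unfolding bump_poly_def by (rule power_dvd_iterated_pderiv) (use assms in simp)
  then obtain r where "(pderiv ^^ j) (bump_poly n) = [:0, 4, -4:] ^ (n + 2 - j) * r" by (auto simp: dvd_def)
  with assms show ?thesis by auto
qed

lemma bump_nonzero_imp: "j \<le> n + 1 \<Longrightarrow> bump n j t \<noteq> 0 \<Longrightarrow> 0 < t \<and> t < 1"
  using bump_poly_boundary[of j n t] by (auto simp: bump_def less_le split: if_splits)

lemma bump_half: "bump n 0 (1 / 2) = 1"
  by (simp add: bump_def bump_poly_def)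

text \<open>At the end points the difference quotient of the bump is dominated by that of the polynomial, which
  tends to \<open>0\<close> there.\<close>
lemma bump_has_derivative:
  assumes "j \<le> n"
  shows "(bump n j has_real_derivative bump n (Suc j) t) (at t)"
proof -
  let ?p = "(pderiv ^^ j) (bump_poly n)"
  consider "t < 0 \<or> 1 < t" | "0 < t" "t < 1" | "t \<in> {0, 1}" by fastforce
  then show ?thesis
  proof cases
    case 1
    have "((\<lambda>_. 0) has_real_derivative 0) (at t)" by simp
    then have "(bump n j has_real_derivative 0) (at t)"
      by (rule has_field_derivative_transform_within_open[where S = "{..<0} \<union> {1<..}"])
        (use 1 in \<open>auto simp: bump_def\<close>)
    with 1 show ?thesis by (auto simp: bump_def)
  next
    case 2
    have "(poly ?p has_real_derivative poly (pderiv ?p) t) (at t)" by (rule poly_DERIV)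
    then have "(bump n j has_real_derivative poly (pderiv ?p) t) (at t)"
      by (rule has_field_derivative_transform_within_open[where S = "{0<..<1}"])
        (use 2 in \<open>auto simp: bump_def\<close>)
    with 2 show ?thesis by (simp add: bump_def)
  next
    case 3
    have z: "poly ?p t = 0" "poly (pderiv ?p) t = 0"
      using bump_poly_boundary[of j n t] bump_poly_boundary[of "Suc j" n t] assms 3 by auto
    have b: "bump n j t = 0" "bump n (Suc j) t = 0" using z by (auto simp: bump_def)
    have "(poly ?p has_real_derivative 0) (at t)" using poly_DERIV[of ?p t] z by simp
    then have lim: "((\<lambda>y. (poly ?p y - poly ?p t) / (y - t)) \<longlongrightarrow> 0) (at t)"
      by (simp add: has_field_derivative_iff)
    have "((\<lambda>y. (bump n j y - bump n j t) / (y - t)) \<longlongrightarrow> 0) (at t)"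
      by (rule Lim_null_comparison[OF _ tendsto_norm_zero[OF lim]])
        (auto simp: b z bump_def intro!: always_eventually)
    with b show ?thesis by (simp add: has_field_derivative_iff)
  qed
qed

lemma bump_bounded:
  obtains B where "1 \<le> B" "\<forall>j\<le>n. \<forall>t. \<bar>bump n j t\<bar> \<le> B"
proof -
  have "\<exists>b\<ge>0. \<forall>t. \<bar>bump n j t\<bar> \<le> b" for j
  proof -
    have "compact (poly ((pderiv ^^ j) (bump_poly n)) ` {0..1})"
      by (intro compact_continuous_image continuous_intros) auto
    then obtain b where "\<forall>y \<in> poly ((pderiv ^^ j) (bump_poly n)) ` {0..1}. norm y \<le> b"
      using compact_imp_bounded bounded_iff by metis
    then have "\<forall>t. \<bar>bump n j t\<bar> \<le> max b 0" by (auto simp: bump_def le_max_iff_disj)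
    then show ?thesis by (intro exI[of _ "max b 0"]) auto
  qed
  then obtain b where b: "\<And>j. 0 \<le> b j" "\<And>j t. \<bar>bump n j t\<bar> \<le> b j" by metis
  have "\<bar>bump n j t\<bar> \<le> 1 + (\<Sum>j\<le>n. b j)" if "j \<le> n" for j t
    using b(2)[of j t] member_le_sum[of j "{..n}" b] b(1) that by fastforce
  moreover have "1 \<le> 1 + (\<Sum>j\<le>n. b j)" using b(1) by (simp add: sum_nonneg)
  ultimately show ?thesis using that by blast
qed

section \<open>Sums of bumps in the Sobolev ball\<close>
definition cells :: "nat \<Rightarrow> ('m :: finite \<Rightarrow> nat) set" where
  "cells N = PiE UNIV (\<lambda>_. {..<N})"

lemma finite_cells: "finite (cells N :: ('m :: finite \<Rightarrow> nat) set)"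
  by (simp add: cells_def finite_PiE)

lemma card_cells: "card (cells N :: ('m :: finite \<Rightarrow> nat) set) = N ^ CARD('m)"
  by (simp add: cells_def card_PiE)

text \<open>The derivative of multi-index \<open>\<alpha>\<close> of the bump in the cell \<open>k\<close> of side length \<open>1 / N\<close>, without the power
  of \<open>N\<close> that the chain rule produces. That power is a factor in \<open>bump_sum\<close>, whose argument \<open>S\<close>
  is the set of cells with a bump and whose argument \<open>h\<close> is the height of the bumps.\<close>
definition cell_bump :: "nat \<Rightarrow> nat \<Rightarrow> ('m :: finite \<Rightarrow> nat) \<Rightarrow> nat ^ 'm \<Rightarrow> real ^ 'm \<Rightarrow> real" where
  "cell_bump n N k \<alpha> x = (\<Prod>i\<in>UNIV. bump n (vec_nth \<alpha> i) (real N * vec_nth x i - real (k i)))"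

definition bump_sum :: "nat \<Rightarrow> nat \<Rightarrow> real \<Rightarrow> ('m :: finite \<Rightarrow> nat) set \<Rightarrow> nat ^ 'm \<Rightarrow> real ^ 'm \<Rightarrow> real" where
  "bump_sum n N h S \<alpha> x = h * real N ^ multi_order \<alpha> * (\<Sum>k\<in>S. cell_bump n N k \<alpha> x)"

lemma multi_order_add_axis: "multi_order (\<alpha> + axis i 1) = Suc (multi_order \<alpha>)"
  by (simp add: multi_order_def sum.distrib axis_def)

lemma nth_le_multi_order: "vec_nth \<alpha> i \<le> multi_order \<alpha>"
  unfolding multi_order_def by (rule member_le_sum) auto

lemma cell_bump_has_derivative:
  assumes "multi_order \<alpha> \<le> n"
  shows "(cell_bump n N k \<alpha> has_derivative
    (\<lambda>y. real N * (\<Sum>i\<in>UNIV. cell_bump n N k (\<alpha> + axis i 1) x * vec_nth y i))) (at x within T)"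
proof -
  let ?t = "\<lambda>i x. real N * vec_nth x i - real (k i)"
  let ?b = "\<lambda>i x. bump n (vec_nth \<alpha> i) (?t i x)"
  have 1: "(?b i has_derivative (\<lambda>y. (real N * vec_nth y i) * bump n (Suc (vec_nth \<alpha> i)) (?t i x))) (at x within T)" for i
  proof (rule DERIV_compose_FDERIV[where g = "?t i" and g' = "\<lambda>y. real N * vec_nth y i"])
    show "(bump n (vec_nth \<alpha> i) has_real_derivative bump n (Suc (vec_nth \<alpha> i)) (?t i x)) (at (?t i x))"
      by (rule bump_has_derivative) (use nth_le_multi_order[of \<alpha> i] assms in linarith)
    have "((\<lambda>x. vec_nth x i) has_derivative (\<lambda>y. vec_nth y i)) (at x within T)"
      by (rule bounded_linear_imp_has_derivative) (rule bounded_linear_vec_nth)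
    then show "((\<lambda>x. ?t i x) has_derivative (\<lambda>y. real N * vec_nth y i)) (at x within T)"
      by (auto intro!: derivative_eq_intros)
  qed
  have "((\<lambda>x. \<Prod>i\<in>UNIV. ?b i x) has_derivative
    (\<lambda>y. \<Sum>i\<in>UNIV. ((real N * vec_nth y i) * bump n (Suc (vec_nth \<alpha> i)) (?t i x)) * (\<Prod>j\<in>UNIV - {i}. ?b j x))) (at x within T)"
    by (rule has_derivative_prod) (rule 1)
  moreover have "cell_bump n N k (\<alpha> + axis i 1) x = bump n (Suc (vec_nth \<alpha> i)) (?t i x) * (\<Prod>j\<in>UNIV - {i}. ?b j x)" for i
  proof -
    have "cell_bump n N k (\<alpha> + axis i 1) x = bump n (vec_nth (\<alpha> + axis i 1) i) (?t i x) *
        (\<Prod>j\<in>UNIV - {i}. bump n (vec_nth (\<alpha> + axis i 1) j) (?t j x))"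
      unfolding cell_bump_def by (rule prod.remove) auto
    also have "(\<Prod>j\<in>UNIV - {i}. bump n (vec_nth (\<alpha> + axis i 1) j) (?t j x)) = (\<Prod>j\<in>UNIV - {i}. ?b j x)"
      by (rule prod.cong) (auto simp: axis_def)
    finally show ?thesis by (simp add: axis_def)
  qed
  ultimately show ?thesis
    unfolding cell_bump_def[of n N k \<alpha>, abs_def] by (simp add: sum_distrib_left ac_simps)
qed

lemma bump_sum_has_derivative:
  assumes "multi_order \<alpha> \<le> n"
  shows "(bump_sum n N h S \<alpha> has_derivative
    (\<lambda>y. \<Sum>i\<in>UNIV. bump_sum n N h S (\<alpha> + axis i 1) x * vec_nth y i)) (at x within T)"
proof -
  have "((\<lambda>x. h * real N ^ multi_order \<alpha> * (\<Sum>k\<in>S. cell_bump n N k \<alpha> x)) has_derivative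
    (\<lambda>y. h * real N ^ multi_order \<alpha> *
      (\<Sum>k\<in>S. real N * (\<Sum>i\<in>UNIV. cell_bump n N k (\<alpha> + axis i 1) x * vec_nth y i)))) (at x within T)"
    by (intro has_derivative_mult_right has_derivative_sum cell_bump_has_derivative assms)
  moreover have "h * real N ^ multi_order \<alpha> *
      (\<Sum>k\<in>S. real N * (\<Sum>i\<in>UNIV. cell_bump n N k (\<alpha> + axis i 1) x * vec_nth y i))
    = (\<Sum>i\<in>UNIV. bump_sum n N h S (\<alpha> + axis i 1) x * vec_nth y i)" for y
    unfolding bump_sum_def multi_order_add_axis
    by (subst sum.swap[of _ UNIV S, symmetric] | simp add: sum_distrib_left sum_distrib_right ac_simps)+
  ultimately show ?thesis unfolding bump_sum_def[of n N h S \<alpha>, abs_def] by simp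
qed

text \<open>The bumps have disjoint supports: the cell of a point is read off from the integer parts of its
  scaled coordinates. Hence at most one summand of a sum of bumps is nonzero at each point, and the
  bounds below do not depend on the number of bumps.\<close>
lemma cell_bump_nonzero_imp:
  assumes "cell_bump n N k \<alpha> x \<noteq> 0" "multi_order \<alpha> \<le> n"
  shows "k = (\<lambda>i. nat \<lfloor>real N * vec_nth x i\<rfloor>)"
proof
  fix i
  have "bump n (vec_nth \<alpha> i) (real N * vec_nth x i - real (k i)) \<noteq> 0"
    using assms(1) by (auto simp: cell_bump_def)
  from bump_nonzero_imp[OF _ this] have "0 < real N * vec_nth x i - real (k i)" "real N * vec_nth x i - real (k i) < 1"
    using nth_le_multi_order[of \<alpha> i] assms(2) by auto
  then have "\<lfloor>real N * vec_nth x i\<rfloor> = int (k i)" by (intro floor_unique) auto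
  then show "k i = nat \<lfloor>real N * vec_nth x i\<rfloor>" by simp
qed

lemma sum_cell_bump_eq:
  assumes "multi_order \<alpha> \<le> n" "finite S" "k = (\<lambda>i. nat \<lfloor>real N * vec_nth x i\<rfloor>)"
  shows "(\<Sum>k\<in>S. cell_bump n N k \<alpha> x) = (if k \<in> S then cell_bump n N k \<alpha> x else 0)"
proof -
  have "(\<Sum>k\<in>S. cell_bump n N k \<alpha> x) = (\<Sum>k\<in>S \<inter> {k}. cell_bump n N k \<alpha> x)"
    using assms cell_bump_nonzero_imp[OF _ assms(1)] by (intro sum.mono_neutral_right) auto
  then show ?thesis by simp
qed

lemma bump_sum_bounded:
  fixes S :: "('m :: finite \<Rightarrow> nat) set"
  assumes B: "\<And>j t. j \<le> n \<Longrightarrow> \<bar>bump n j t\<bar> \<le> B" "1 \<le> B" and "multi_order \<alpha> \<le> n" "finite S" "0 \<le> h"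
  shows "\<bar>bump_sum n N h S \<alpha> x\<bar> \<le> h * real N ^ multi_order \<alpha> * B ^ CARD('m)"
proof -
  have "\<bar>cell_bump n N k \<alpha> x\<bar> \<le> B ^ CARD('m)" for k
  proof -
    have "\<bar>cell_bump n N k \<alpha> x\<bar> = (\<Prod>i\<in>UNIV. \<bar>bump n (vec_nth \<alpha> i) (real N * vec_nth x i - real (k i))\<bar>)"
      by (simp add: cell_bump_def abs_prod)
    also have "\<dots> \<le> (\<Prod>i\<in>(UNIV :: 'm set). B)"
      using B(1) order_trans[OF nth_le_multi_order assms(3)] by (intro prod_mono) auto
    finally show ?thesis by simp
  qed
  then have "\<bar>\<Sum>k\<in>S. cell_bump n N k \<alpha> x\<bar> \<le> B ^ CARD('m)"
    using B(2) by (simp add: sum_cell_bump_eq[OF assms(3,4) refl])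
  then show ?thesis
    using \<open>0 \<le> h\<close> by (simp add: bump_sum_def abs_mult mult_left_mono)
qed

lemma finite_multi_order_le: "finite {\<alpha> :: nat ^ 'm. multi_order \<alpha> \<le> n}"
proof -
  have "{\<alpha> :: nat ^ 'm. multi_order \<alpha> \<le> n} \<subseteq> vec_lambda ` (PiE UNIV (\<lambda>_. {..n}))"
  proof
    fix \<alpha> :: "nat ^ 'm" assume "\<alpha> \<in> {\<alpha>. multi_order \<alpha> \<le> n}"
    then have "vec_nth \<alpha> \<in> PiE UNIV (\<lambda>_. {..n})" using order_trans[OF nth_le_multi_order[of \<alpha>]] by auto
    then show "\<alpha> \<in> vec_lambda ` (PiE UNIV (\<lambda>_. {..n}))" by (metis imageI vec_nth_inverse)
  qed
  then show ?thesis by (rule finite_subset) (auto intro!: finite_imageI finite_PiE)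
qed

text \<open>Membership in the unit ball can be checked on any derivative family, by pointwise bounds: these
  bound the essential suprema, and the partial derivatives are unique on the cube.\<close>
lemma sobolev_ballI:
  fixes f :: "real ^ 'm \<Rightarrow> real"
  assumes D: "derivative_family (n - 1) unit_cube f D"
    and le: "\<And>\<alpha> x. multi_order \<alpha> \<le> n - 1 \<Longrightarrow> x \<in> unit_cube \<Longrightarrow> \<bar>D \<alpha> x\<bar> \<le> 1"
    and lip: "\<And>\<alpha>. multi_order \<alpha> = n - 1 \<Longrightarrow> 1-lipschitz_on unit_cube (D \<alpha>)"
  shows "f \<in> sobolev_ball n"
proof -
  have eq: "partial_deriv unit_cube \<alpha> f x = D \<alpha> x" if "multi_order \<alpha> \<le> n - 1" "x \<in> unit_cube" for \<alpha> x
    using partial_deriv_eq[OF D] that .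
  have lip': "1-lipschitz_on unit_cube (partial_deriv unit_cube \<alpha> f)" if "multi_order \<alpha> = n - 1" for \<alpha>
    using lip[OF that] eq[of \<alpha>] that by (auto simp: lipschitz_on_def)
  have sp: "f \<in> sobolev_space n unit_cube"
    using D lip' by (auto simp: sobolev_space_def cont_differentiable_def)
  have Linf: "Linf_norm unit_cube (partial_deriv unit_cube \<alpha> f) \<le> 1" if "multi_order \<alpha> \<le> n - 1" for \<alpha>
  proof -
    have "continuous_on unit_cube (D \<alpha>)" using D that by (simp add: derivative_family_def)
    then have "continuous_on unit_cube (\<lambda>x. norm (partial_deriv unit_cube \<alpha> f x))"
      using eq[OF that] by (intro continuous_on_norm) (metis (no_types, lifting) continuous_on_cong)
    then have "(\<lambda>x. norm (partial_deriv unit_cube \<alpha> f x)) \<in> borel_measurable (lebesgue_on unit_cube)"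
      by (rule continuous_imp_measurable_on_sets_lebesgue) (simp add: unit_cube_eq_cbox)
    then have "(\<lambda>x. ereal (norm (partial_deriv unit_cube \<alpha> f x))) \<in> borel_measurable (lebesgue_on unit_cube)"
      by measurable
    then show ?thesis unfolding Linf_norm_def
      by (rule esssup_I) (use le eq that in \<open>auto intro!: AE_I2\<close>)
  qed
  have Lip: "Lip_const unit_cube (partial_deriv unit_cube \<alpha> f) \<le> 1" if "multi_order \<alpha> = n - 1" for \<alpha>
    unfolding Lip_const_def using lip'[OF that] by (intro Inf_lower) (auto simp: one_ereal_def)
  have fin: "finite {\<alpha> :: nat ^ 'm. multi_order \<alpha> \<le> n - 1}" "finite {\<alpha> :: nat ^ 'm. multi_order \<alpha> = n - 1}"
    using finite_multi_order_le[of "n - 1"] by (auto elim: rev_finite_subset)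
  obtain i :: 'm where True by simp
  have "multi_order (axis i (n - 1)) = n - 1" by (simp add: multi_order_def axis_def)
  then have ne: "{\<alpha> :: nat ^ 'm. multi_order \<alpha> \<le> n - 1} \<noteq> {}" "{\<alpha> :: nat ^ 'm. multi_order \<alpha> = n - 1} \<noteq> {}"
    by (metis (mono_tags, lifting) empty_Collect_eq order_refl)+
  have "sobolev_norm n unit_cube f \<le> 1"
    unfolding sobolev_norm_def using fin ne Linf Lip by (auto simp: Max_le_iff)
  with sp show ?thesis by (simp add: sobolev_ball_def)
qed

text \<open>The height \<open>h\<close> is chosen such that every derivative of order at most \<open>n\<close> is bounded by \<open>1 / m\<close>, where
  \<open>m\<close> is the dimension. For the derivatives of order \<open>n - 1\<close>, the gradient then has operator norm at most
  \<open>1\<close>, so that they are 1-Lipschitz on the convex cube.\<close>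
lemma bump_sum_in_sobolev_ball:
  fixes S :: "('m :: finite \<Rightarrow> nat) set"
  assumes B: "\<And>j t. j \<le> n \<Longrightarrow> \<bar>bump n j t\<bar> \<le> B" "1 \<le> B" and "1 \<le> n" "1 \<le> N" "finite S"
  defines "h \<equiv> 1 / (real CARD('m) * B ^ CARD('m) * real N ^ n)"
  shows "bump_sum n N h S 0 \<in> sobolev_ball n"
proof (rule sobolev_ballI)
  have m: "1 \<le> real CARD('m)" by (simp add: Suc_leI)
  have h: "0 \<le> h" using B(2) by (simp add: h_def)
  have bd: "\<bar>bump_sum n N h S \<alpha> x\<bar> \<le> 1 / real CARD('m)" if "multi_order \<alpha> \<le> n" for \<alpha> x
  proof -
    have "\<bar>bump_sum n N h S \<alpha> x\<bar> \<le> h * real N ^ multi_order \<alpha> * B ^ CARD('m)"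
      by (rule bump_sum_bounded[OF B that \<open>finite S\<close> h])
    also have "\<dots> \<le> h * real N ^ n * B ^ CARD('m)"
      using that \<open>1 \<le> N\<close> B(2) h by (intro mult_right_mono mult_left_mono power_increasing) auto
    also have "\<dots> = 1 / real CARD('m)" using B(2) \<open>1 \<le> N\<close> by (simp add: h_def)
    finally show ?thesis .
  qed
  show "derivative_family (n - 1) unit_cube (bump_sum n N h S 0) (bump_sum n N h S)"
    unfolding derivative_family_def
  proof (intro conjI allI impI ballI)
    fix \<alpha> :: "nat ^ 'm" assume "multi_order \<alpha> \<le> n - 1"
    then show "continuous_on unit_cube (bump_sum n N h S \<alpha>)"
      by (intro has_derivative_continuous_on[OF bump_sum_has_derivative]) auto
  qed (rule refl | rule bump_sum_has_derivative, simp)+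
  show "\<bar>bump_sum n N h S \<alpha> x\<bar> \<le> 1" if "multi_order \<alpha> \<le> n - 1" for \<alpha> x
  proof -
    have "\<bar>bump_sum n N h S \<alpha> x\<bar> \<le> 1 / real CARD('m)" using that by (intro bd) simp
    also have "\<dots> \<le> 1" using m by simp
    finally show ?thesis .
  qed
  show "1-lipschitz_on unit_cube (bump_sum n N h S \<alpha>)" if \<alpha>: "multi_order \<alpha> = n - 1" for \<alpha>
  proof (rule lipschitz_onI)
    fix x y :: "real ^ 'm" assume xy: "x \<in> unit_cube" "y \<in> unit_cube"
    have "norm (bump_sum n N h S \<alpha> x - bump_sum n N h S \<alpha> y) \<le> 1 * norm (x - y)"
    proof (rule differentiable_bound[OF _ bump_sum_has_derivative _ xy])
      show "convex (unit_cube :: (real ^ 'm) set)" by (simp add: unit_cube_eq_cbox convex_box)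
      show "multi_order \<alpha> \<le> n" using \<alpha> by simp
      show "onorm (\<lambda>v. \<Sum>i\<in>UNIV. bump_sum n N h S (\<alpha> + axis i 1) z * vec_nth v i) \<le> 1" for z
      proof (rule onorm_le)
        fix v :: "real ^ 'm"
        have "norm (\<Sum>i\<in>UNIV. bump_sum n N h S (\<alpha> + axis i 1) z * vec_nth v i)
            \<le> (\<Sum>i\<in>(UNIV :: 'm set). 1 / real CARD('m) * norm v)"
        proof (intro order_trans[OF norm_sum] sum_mono)
          fix i
          have "multi_order (\<alpha> + axis i 1) \<le> n" using multi_order_add_axis[of \<alpha> i] \<alpha> \<open>1 \<le> n\<close> by linarith
          then show "norm (bump_sum n N h S (\<alpha> + axis i 1) z * vec_nth v i) \<le> 1 / real CARD('m) * norm v"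
            unfolding real_norm_def abs_mult by (intro mult_mono bd component_le_norm_cart) auto
        qed
        also have "\<dots> = 1 * norm v" by simp
        finally show "norm (\<Sum>i\<in>UNIV. bump_sum n N h S (\<alpha> + axis i 1) z * vec_nth v i) \<le> 1 * norm v" .
      qed
    qed
    then show "dist (bump_sum n N h S \<alpha> x) (bump_sum n N h S \<alpha> y) \<le> 1 * dist x y"
      by (simp add: dist_norm)
  qed simp
qed

lemma multi_order_zero [simp]: "multi_order 0 = 0"
  by (simp add: multi_order_def)

text \<open>In a cell that belongs to only one of the two sets, the difference is a single bump, up to sign. It
  has the value \<open>h\<close> at the centre and, by continuity, exceeds \<open>\<eta>\<close> on a neighbourhood. An open set is needed
  because approximation is only assumed almost everywhere.\<close>
lemma bump_sum_separated:
  fixes S S' :: "('m :: finite \<Rightarrow> nat) set"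
  assumes "S \<subseteq> cells N" "S' \<subseteq> cells N" "S \<noteq> S'" "1 \<le> N" "0 < h" "\<eta> < h"
  obtains U where "open U" "U \<noteq> {}" "U \<subseteq> unit_cube"
    "\<forall>x\<in>U. \<eta> < \<bar>bump_sum n N h S 0 x - bump_sum n N h S' 0 x\<bar>"
proof -
  obtain k where k: "k \<in> S \<and> k \<notin> S' \<or> k \<in> S' \<and> k \<notin> S" using assms(3) by blast
  have kN: "k i < N" for i using k assms(1,2) by (auto simp: cells_def)
  have fin: "finite S" "finite S'" using assms(1,2) finite_cells finite_subset by blast+
  define U where "U = {x :: real ^ 'm. (\<forall>i. real (k i) < real N * vec_nth x i \<and> real N * vec_nth x i < real (k i) + 1)
    \<and> \<eta> < h * \<bar>cell_bump n N k 0 x\<bar>}"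
  have cont: "continuous_on UNIV (cell_bump n N k 0)"
    by (rule has_derivative_continuous_on[OF cell_bump_has_derivative]) simp
  have "U = (\<Inter>i. {x. real (k i) < real N * vec_nth x i} \<inter> {x. real N * vec_nth x i < real (k i) + 1})
      \<inter> {x. \<eta> < h * \<bar>cell_bump n N k 0 x\<bar>}"
    by (auto simp: U_def)
  then have "open U"
    by (auto intro!: open_Int open_INT open_Collect_less continuous_intros cont)
  moreover have "(\<chi> i. (real (k i) + 1 / 2) / real N) \<in> U"
    using \<open>1 \<le> N\<close> \<open>\<eta> < h\<close> by (simp add: U_def cell_bump_def bump_half)
  moreover have "U \<subseteq> unit_cube"
  proof
    fix x assume x: "x \<in> U"
    have "0 \<le> vec_nth x i \<and> vec_nth x i \<le> 1" for i
    proof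
      have *: "real (k i) < real N * vec_nth x i" "real N * vec_nth x i < real (k i) + 1"
        using x by (auto simp: U_def)
      have "0 < real N * vec_nth x i" using *(1) by linarith
      then show "0 \<le> vec_nth x i" using \<open>1 \<le> N\<close> by (simp add: zero_less_mult_iff)
      have "real (k i) + 1 \<le> real N" using kN[of i] by simp
      then have "real N * vec_nth x i \<le> real N * 1" using *(2) by linarith
      then show "vec_nth x i \<le> 1" by (rule mult_left_le_imp_le) (use \<open>1 \<le> N\<close> in simp)
    qed
    then show "x \<in> unit_cube" by (simp add: unit_cube_def)
  qed
  moreover have "\<eta> < \<bar>bump_sum n N h S 0 x - bump_sum n N h S' 0 x\<bar>" if x: "x \<in> U" for x
  proof -
    have kx: "k = (\<lambda>i. nat \<lfloor>real N * vec_nth x i\<rfloor>)"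
    proof
      fix i
      have "\<lfloor>real N * vec_nth x i\<rfloor> = int (k i)" using x by (intro floor_unique) (auto simp: U_def intro: less_imp_le)
      then show "k i = nat \<lfloor>real N * vec_nth x i\<rfloor>" by simp
    qed
    have "\<bar>bump_sum n N h S 0 x - bump_sum n N h S' 0 x\<bar> = h * \<bar>cell_bump n N k 0 x\<bar>"
      using k \<open>0 < h\<close> by (auto simp: bump_sum_def abs_mult sum_cell_bump_eq[OF _ fin(1) kx] sum_cell_bump_eq[OF _ fin(2) kx])
    with x show ?thesis by (simp add: U_def)
  qed
  ultimately show ?thesis by (intro that) auto
qed

section \<open>Packing against covering\<close>

lemma continuous_on_realify: "continuous_on UNIV (realify :: complex ^ 'd \<Rightarrow> real ^ ('d + 'd))"
proof -
  have "continuous_on UNIV (\<lambda>z :: complex ^ 'd. case i of Inl k \<Rightarrow> Re (vec_nth z k) | Inr k \<Rightarrow> Im (vec_nth z k))"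
    for i :: "'d + 'd"
    by (cases i) (auto intro!: continuous_intros)
  then show ?thesis unfolding realify_def by (intro continuous_on_vec_lambda)
qed

lemma surj_realify: "surj (realify :: complex ^ 'd \<Rightarrow> real ^ ('d + 'd))"
proof (rule surjI)
  fix x :: "real ^ ('d + 'd)"
  show "realify (\<chi> k. Complex (vec_nth x (Inl k)) (vec_nth x (Inr k))) = x"
    by (auto simp: realify_def Finite_Cartesian_Product.vec_eq_iff split: sum.split)
qed

lemma realify_in_unit_cube: "realify z \<in> unit_cube \<longleftrightarrow> z \<in> complex_cube"
proof
  assume u: "realify z \<in> unit_cube"
  have "vec_nth (realify z) (Inl k) \<in> {0..1}" "vec_nth (realify z) (Inr k) \<in> {0..1}" for k
    using u unfolding unit_cube_def by blast+
  then show "z \<in> complex_cube" by (simp add: realify_def complex_cube_def)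
next
  assume "z \<in> complex_cube"
  then show "realify z \<in> unit_cube" using bij_betwE[OF bij_betw_realify] by blast
qed

lemma complex_cube_lebesgue: "(complex_cube :: (complex ^ 'd) set) \<in> sets lebesgue"
proof -
  have "(complex_cube :: (complex ^ 'd) set) = realify -` unit_cube" by (auto simp: realify_in_unit_cube)
  moreover have "closed (realify -` unit_cube :: (complex ^ 'd) set)"
    by (rule closed_vimage) (simp_all add: unit_cube_eq_cbox continuous_on_realify closed_cbox)
  ultimately show ?thesis by (simp add: borel_closed)
qed

lemma Linf_norm_le_imp_AE:
  assumes "Linf_norm S f \<le> ereal c"
  shows "AE x in lebesgue_on S. norm (f x) \<le> c"
  using esssup_AE[of "\<lambda>x. ereal (norm (f x))" "lebesgue_on S"]
proof eventually_elim
  case (elim x)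
  then have "ereal (norm (f x)) \<le> ereal c" using assms unfolding Linf_norm_def by (rule order_trans)
  then show ?case by simp
qed

lemma AE_lebesgue_on_imp_exists_in_open:
  fixes S :: "'a :: euclidean_space set"
  assumes "AE x in lebesgue_on S. P x" "S \<in> sets lebesgue" "open V" "V \<noteq> {}" "V \<subseteq> S"
  shows "\<exists>x\<in>V. P x"
proof (rule ccontr)
  assume "\<not> ?thesis"
  then have sub: "V \<subseteq> {x. \<not> (x \<in> S \<longrightarrow> P x)}" using assms(5) by auto
  have "AE x in lebesgue. x \<in> S \<longrightarrow> P x"
    using assms(1,2) by (simp add: AE_restrict_space_iff)
  then obtain N where "N \<in> null_sets lebesgue" "{x. \<not> (x \<in> S \<longrightarrow> P x)} \<subseteq> N"
    by (auto simp: eventually_ae_filter)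
  then have "negligible V" using sub by (meson negligible_iff_null_sets negligible_subset order_trans)
  then show False using open_not_negligible assms(3,4) by blast
qed

text \<open>The lower count. If two sets of cells were assigned the same element of \<open>G\<close>, the corresponding bump
  functions would differ by at most \<open>\<epsilon> + 2 * \<delta>\<close> almost everywhere, which contradicts their separation
  on a nonempty open set. Hence the assignment is injective on the \<open>2 ^ (N ^ (2 * d))\<close> sets of cells.\<close>
lemma packing_le_covering:
  fixes G :: "(complex ^ 'd \<Rightarrow> complex) set"
  assumes "finite G" "1 \<le> N" "0 < h" "\<epsilon> + 2 * \<delta> < h"
    and appr: "\<And>S. S \<subseteq> cells N \<Longrightarrow> \<exists>f. (\<exists>g\<in>G. \<forall>z\<in>complex_cube. cmod (f z - g z) \<le> \<delta>) \<and>
      Linf_norm complex_cube (\<lambda>z. complex_of_real (bump_sum n N h S 0 (realify z)) - f z) \<le> ereal (\<epsilon> / 2)"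
  shows "2 ^ (N ^ (2 * CARD('d))) \<le> card G"
proof -
  let ?b = "\<lambda>S z. complex_of_real (bump_sum n N h S 0 (realify z :: real ^ ('d + 'd)))"
  have "\<exists>g. S \<subseteq> cells N \<longrightarrow> g \<in> G \<and> (AE z in lebesgue_on complex_cube. cmod (?b S z - g z) \<le> \<epsilon> / 2 + \<delta>)" for S
  proof (cases "S \<subseteq> cells N")
    case True
    from appr[OF True] obtain f where g: "\<exists>g\<in>G. \<forall>z\<in>complex_cube. cmod (f z - g z) \<le> \<delta>"
      and f: "Linf_norm complex_cube (\<lambda>z. ?b S z - f z) \<le> ereal (\<epsilon> / 2)"
      by (elim exE conjE) (rule that)
    from g obtain g where g: "g \<in> G" "\<forall>z\<in>complex_cube. cmod (f z - g z) \<le> \<delta>"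
      by (elim bexE) (rule that)
    have "AE z in lebesgue_on complex_cube. z \<in> (complex_cube :: (complex ^ 'd) set)"
      by (rule AE_I2) (simp add: space_restrict_space)
    with Linf_norm_le_imp_AE[OF f] have "AE z in lebesgue_on complex_cube. cmod (?b S z - g z) \<le> \<epsilon> / 2 + \<delta>"
    proof eventually_elim
      case (elim z)
      then show ?case by (intro norm_diff_triangle_le[where y = "f z"] g(2)[rule_format])
    qed
    with g(1) show ?thesis by (intro exI[of _ g]) simp
  qed simp
  then have "\<forall>S. \<exists>g. S \<subseteq> cells N \<longrightarrow> g \<in> G \<and> (AE z in lebesgue_on complex_cube. cmod (?b S z - g z) \<le> \<epsilon> / 2 + \<delta>)"
    by (rule allI)
  from choice[OF this] obtain g where g: "\<And>S. S \<subseteq> cells N \<Longrightarrow> g S \<in> G"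
    "\<And>S. S \<subseteq> cells N \<Longrightarrow> AE z in lebesgue_on complex_cube. cmod (?b S z - g S z) \<le> \<epsilon> / 2 + \<delta>"
    by auto
  have "inj_on g (Pow (cells N))"
  proof (rule inj_onI, rule ccontr)
    fix S S' assume S: "S \<in> Pow (cells N)" "S' \<in> Pow (cells N)" "g S = g S'" "S \<noteq> S'"
    then have sub: "S \<subseteq> cells N" "S' \<subseteq> cells N" by auto
    obtain U where U: "open U" "U \<noteq> {}" "U \<subseteq> unit_cube"
      "\<forall>x\<in>U. \<epsilon> + 2 * \<delta> < \<bar>bump_sum n N h S 0 x - bump_sum n N h S' 0 x\<bar>"
      by (rule bump_sum_separated[OF sub \<open>S \<noteq> S'\<close> assms(2-4)], rule that)
    have "open (realify -` U)" by (rule open_vimage[OF U(1) continuous_on_realify])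
    moreover have "realify -` U \<noteq> {}"
    proof -
      obtain x where "x \<in> U" using U(2) by blast
      moreover obtain z where "x = realify z" using surjD[OF surj_realify] by blast
      ultimately show ?thesis by blast
    qed
    moreover have "realify -` U \<subseteq> complex_cube" using U(3) realify_in_unit_cube by blast
    moreover have "AE z in lebesgue_on complex_cube. cmod (?b S z - ?b S' z) \<le> \<epsilon> + 2 * \<delta>"
      using g(2)[OF sub(1)] g(2)[OF sub(2)]
    proof eventually_elim
      case (elim z)
      have "cmod (g S z - ?b S' z) \<le> \<epsilon> / 2 + \<delta>" using elim(2) S(3) by (simp only: norm_minus_commute)
      from norm_diff_triangle_le[OF elim(1) this] show ?case by simp
    qed
    ultimately have "\<exists>z\<in>realify -` U. cmod (?b S z - ?b S' z) \<le> \<epsilon> + 2 * \<delta>"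
      by (intro AE_lebesgue_on_imp_exists_in_open[OF _ complex_cube_lebesgue])
    then obtain z where "realify z \<in> U" "cmod (?b S z - ?b S' z) \<le> \<epsilon> + 2 * \<delta>" by blast
    moreover have "cmod (?b S z - ?b S' z) = \<bar>bump_sum n N h S 0 (realify z) - bump_sum n N h S' 0 (realify z)\<bar>"
      by (simp only: of_real_diff[symmetric] norm_of_real)
    ultimately show False using U(4) by fastforce
  qed
  then have "card (Pow (cells N :: ('d + 'd \<Rightarrow> nat) set)) \<le> card G"
    using g(1) assms(1) by (intro card_inj_on_le) auto
  then show ?thesis by (simp add: card_Pow finite_cells card_cells mult_2)
qed

text \<open>With \<open>x = 1 / \<epsilon>\<close>, the left-hand side bounds the logarithm of the number of rounded networks and the
  right-hand side is the logarithm of the number of bump functions: up to powers of \<open>ln x\<close>, the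
  comparison is between \<open>x powr \<gamma>\<close> and \<open>x powr \<mu>\<close>.\<close>
lemma polynomial_growth_dominates:
  fixes \<gamma> \<mu> \<theta> \<kappa> C D c :: real
  assumes "0 < \<gamma>" "\<gamma> < \<mu>" "0 < \<theta>" "0 < \<kappa>" "1 \<le> C" "0 < D" "0 < c"
  shows "\<forall>\<^sub>F x in at_top. (2 * (C * ln (2 * x) powr \<kappa>) + 6) * (C * x powr \<gamma> + 1) *
      ln (64 * x * (C * ln (2 * x) powr \<kappa> + 1) * (C * x powr \<gamma> + D) * (C * x powr \<theta> + 1))
    < (x / c) powr \<mu> * ln 2"
proof -
  have "0 < C" using assms by simp
  then have "((\<lambda>x. (2 * (C * ln (2 * x) powr \<kappa>) + 6) * (C * x powr \<gamma> + 1) *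
      ln (64 * x * (C * ln (2 * x) powr \<kappa> + 1) * (C * x powr \<gamma> + D) * (C * x powr \<theta> + 1))
      / (x / c) powr \<mu>) \<longlongrightarrow> 0) at_top"
    using assms by real_asymp
  then have "\<forall>\<^sub>F x in at_top. (2 * (C * ln (2 * x) powr \<kappa>) + 6) * (C * x powr \<gamma> + 1) *
      ln (64 * x * (C * ln (2 * x) powr \<kappa> + 1) * (C * x powr \<gamma> + D) * (C * x powr \<theta> + 1))
      / (x / c) powr \<mu> < ln 2"
    by (rule order_tendstoD) simp
  with eventually_gt_at_top[of 0] show ?thesis
  proof eventually_elim
    case (elim x)
    then have "0 < (x / c) powr \<mu>" using \<open>0 < c\<close> by simp
    with elim(2) show ?case by (simp add: pos_divide_less_eq mult.commute)
  qed
qed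

section \<open>The lower bound on the number of weights\<close>
theorem theorem12:
  fixes n :: nat and \<theta> \<kappa> \<gamma> C\<^sub>0 :: real
  assumes "n \<ge> 1" and "\<theta> \<ge> 0" and "\<kappa> \<ge> 0" and "\<gamma> \<ge> 0" and "C\<^sub>0 \<ge> 1"
    and "\<And>\<epsilon> (g :: complex ^ 'd \<Rightarrow> complex). \<epsilon> \<in> {0<..<1} \<Longrightarrow> g \<in> target_class n \<Longrightarrow>
      \<exists>g\<^sub>\<epsilon> \<Phi>. implements \<Phi> g\<^sub>\<epsilon> \<and>
        real (length \<Phi>) \<le> C\<^sub>0 * ln (2 / \<epsilon>) powr \<kappa> \<and>
        real (num_weights \<Phi>) \<le> C\<^sub>0 * \<epsilon> powr (- \<gamma>) \<and>
        weights_bounded (C\<^sub>0 * \<epsilon> powr (- \<theta>)) \<Phi> \<and>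
        Linf_norm complex_cube (\<lambda>z. g z - g\<^sub>\<epsilon> z) \<le> ereal (\<epsilon> / 2)"
  shows "\<gamma> \<ge> 2 * real CARD('d) / real n"
proof (rule ccontr)
  define m where "m = 2 * CARD('d)"
  have "1 \<le> CARD('d)" by (simp add: Suc_leI)
  then have "1 \<le> m" unfolding m_def by linarith
  then have m: "1 \<le> real m" "CARD('d + 'd) = m" by (simp, simp add: m_def)
  define \<mu> where "\<mu> = real m / real n"
  assume "\<not> \<gamma> \<ge> 2 * real CARD('d) / real n"
  then have \<gamma>\<mu>: "\<gamma> < \<mu>" by (simp add: \<mu>_def m_def)
  \<comment> \<open>The midpoint still lies below \<open>\<mu>\<close> and is positive even for \<open>\<gamma> = 0\<close>; likewise, \<open>\<kappa> + 1\<close> and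
    \<open>\<theta> + 1\<close> below are positive. Positive exponents allow one uniform asymptotic comparison.\<close>
  define \<gamma>' where "\<gamma>' = (\<gamma> + \<mu>) / 2"
  have \<gamma>': "0 < \<gamma>'" "\<gamma> \<le> \<gamma>'" "\<gamma>' < \<mu>" using \<gamma>\<mu> \<open>\<gamma> \<ge> 0\<close> by (auto simp: \<gamma>'_def)
  obtain B where B: "1 \<le> B" "\<forall>j\<le>n. \<forall>t. \<bar>bump n j t\<bar> \<le> B"
    by (rule bump_bounded[of n], rule that)
  \<comment> \<open>This constant relates accuracy and resolution: \<open>1 / \<epsilon> = c * N ^ n\<close> for bumps of height \<open>2 * \<epsilon>\<close>.\<close>
  define c where "c = 2 * real m * B ^ m"
  have c: "2 \<le> c" using mult_mono[of 1 "real m" 1 "B ^ m"] one_le_power[OF B(1), of m] m by (simp add: c_def)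
  define rhs where "rhs x = (2 * (C\<^sub>0 * ln (2 * x) powr (\<kappa> + 1)) + 6) * (C\<^sub>0 * x powr \<gamma>' + 1) *
      ln (64 * x * (C\<^sub>0 * ln (2 * x) powr (\<kappa> + 1) + 1) * (C\<^sub>0 * x powr \<gamma>' + (real CARD('d) + 2)) * (C\<^sub>0 * x powr (\<theta> + 1) + 1))" for x
  have lower: "(x / c) powr \<mu> * ln 2 \<le> rhs x" if N: "1 \<le> N" and x: "x = c * real N ^ n" for N x
  proof -
    define \<epsilon> where "\<epsilon> = 1 / x"
    define h where "h = 2 * \<epsilon>"
    have x2: "2 \<le> x" using mult_mono[of 2 c 1 "real N ^ n"] c one_le_power[of "real N" n] N by (simp add: x)
    have \<epsilon>: "0 < \<epsilon>" "\<epsilon> < 1" "\<epsilon> \<in> {0<..<1}" "0 < \<epsilon> / 4" "\<epsilon> / 4 \<le> 1" using x2 by (auto simp: \<epsilon>_def)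
    have h: "h = 1 / (real CARD('d + 'd) * B ^ CARD('d + 'd) * real N ^ n)" "0 < h"
      using \<epsilon> by (simp_all add: h_def \<epsilon>_def x c_def m(2) del: card_sum)
    define L where "L = nat \<lfloor>C\<^sub>0 * ln (2 / \<epsilon>) powr \<kappa>\<rfloor>"
    define W where "W = nat \<lfloor>C\<^sub>0 * \<epsilon> powr (- \<gamma>)\<rfloor>"
    define K where "K = C\<^sub>0 * \<epsilon> powr (- \<theta>)"
    have x_eps: "2 / \<epsilon> = 2 * x" "\<epsilon> powr (- a) = x powr a" for a
      using x2 by (simp_all add: \<epsilon>_def powr_minus_divide powr_divide)
    have K: "1 \<le> K" using mult_mono[of 1 "C\<^sub>0" 1 "x powr \<theta>"] assms(2,5) x2
      by (simp add: K_def x_eps ge_one_powr_ge_zero)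
    obtain G :: "(complex ^ 'd \<Rightarrow> complex) set" where G: "finite G"
      "real (card G) \<le> (16 * (real L + 1) * (real W + real CARD('d) + 2) * (K + 1) / (\<epsilon> / 4)) ^ ((2 * L + 6) * (W + 1))"
      "\<forall>\<Phi> f. implements \<Phi> f \<and> length \<Phi> \<le> L \<and> num_weights \<Phi> \<le> W \<and> weights_bounded K \<Phi> \<longrightarrow>
         (\<exists>g\<in>G. \<forall>z\<in>complex_cube. cmod (f z - g z) \<le> \<epsilon> / 4)"
      by (rule network_covering[OF K \<open>0 < \<epsilon> / 4\<close> \<open>\<epsilon> / 4 \<le> 1\<close>, where 'd = 'd], rule that)
    have "2 ^ (N ^ (2 * CARD('d))) \<le> card G"
    proof (rule packing_le_covering[OF G(1) N h(2), of \<epsilon> "\<epsilon> / 4" n])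
      fix S :: "('d + 'd \<Rightarrow> nat) set" assume "S \<subseteq> cells N"
      then have "finite S" using finite_cells finite_subset by blast
      have ball: "bump_sum n N h S 0 \<in> sobolev_ball n" if "finite S" for S :: "('d + 'd \<Rightarrow> nat) set"
        unfolding h(1) using B that N assms(1) by (intro bump_sum_in_sobolev_ball) auto
      have "(\<lambda>z. complex_of_real (bump_sum n N h S 0 (realify z))) \<in> target_class n"
        unfolding target_class_def
        by (intro CollectI bexI[OF _ ball[OF \<open>finite S\<close>]] bexI[OF _ ball[OF finite.emptyI]])
          (simp add: bump_sum_def[of n N h "{}"])
      from assms(6)[OF \<epsilon>(3) this] obtain f \<Phi> where f: "implements \<Phi> f"
        "real (length \<Phi>) \<le> C\<^sub>0 * ln (2 / \<epsilon>) powr \<kappa>" "real (num_weights \<Phi>) \<le> C\<^sub>0 * \<epsilon> powr (- \<gamma>)"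
        "weights_bounded K \<Phi>"
        "Linf_norm complex_cube (\<lambda>z. complex_of_real (bump_sum n N h S 0 (realify z)) - f z) \<le> ereal (\<epsilon> / 2)"
        unfolding K_def by blast
      have "length \<Phi> \<le> L" "num_weights \<Phi> \<le> W" using f(2,3) by (simp_all add: L_def W_def le_nat_floor)
      then show "\<exists>f. (\<exists>g\<in>G. \<forall>z\<in>complex_cube. cmod (f z - g z) \<le> \<epsilon> / 4) \<and>
          Linf_norm complex_cube (\<lambda>z. complex_of_real (bump_sum n N h S 0 (realify z)) - f z) \<le> ereal (\<epsilon> / 2)"
        using G(3) f(1,4,5) by blast
    qed (use \<epsilon> in \<open>simp add: h_def\<close>)
    then have "2 ^ (N ^ m) \<le> real (card G)"
      unfolding m_def by (metis of_nat_le_iff of_nat_numeral of_nat_power)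
    also have "\<dots> \<le> (64 * x * (real L + 1) * (real W + (real CARD('d) + 2)) * (K + 1)) ^ ((2 * L + 6) * (W + 1))"
    proof -
      have "16 * (real L + 1) * (real W + real CARD('d) + 2) * (K + 1) / (\<epsilon> / 4)
          = 64 * x * (real L + 1) * (real W + (real CARD('d) + 2)) * (K + 1)"
        using x2 by (simp add: \<epsilon>_def algebra_simps)
      with G(2) show ?thesis by (simp only:)
    qed
    finally have count: "2 ^ (N ^ m) \<le> (64 * x * (real L + 1) * (real W + (real CARD('d) + 2)) * (K + 1)) ^ ((2 * L + 6) * (W + 1))"
      (is "_ \<le> ?P ^ ?e") .
    have lnx: "1 \<le> ln (2 * x)"
    proof -
      have "exp 1 \<le> 2 * x" using x2 exp_le by linarith
      then show ?thesis using ln_ge_iff[of "2 * x" 1] x2 by simp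
    qed
    have L: "real L \<le> C\<^sub>0 * ln (2 * x) powr (\<kappa> + 1)"
    proof -
      have "real L \<le> C\<^sub>0 * ln (2 * x) powr \<kappa>" using assms(5) by (simp add: L_def x_eps)
      also have "\<dots> \<le> C\<^sub>0 * ln (2 * x) powr (\<kappa> + 1)"
        using assms(5) lnx by (intro mult_left_mono powr_mono) auto
      finally show ?thesis .
    qed
    have W: "real W \<le> C\<^sub>0 * x powr \<gamma>'"
    proof -
      have "real W \<le> C\<^sub>0 * x powr \<gamma>" using assms(5) by (simp add: W_def x_eps)
      also have "\<dots> \<le> C\<^sub>0 * x powr \<gamma>'" using assms(5) x2 \<gamma>' by (intro mult_left_mono powr_mono) auto
      finally show ?thesis .
    qed
    have K': "K \<le> C\<^sub>0 * x powr (\<theta> + 1)"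
      unfolding K_def x_eps using assms(5) x2 by (intro mult_left_mono powr_mono) auto
    have P1: "1 \<le> ?P"
    proof -
      have "1 * 1 * 1 * 1 \<le> ?P" using x2 K by (intro mult_mono) auto
      then show ?thesis by simp
    qed
    have "(x / c) powr \<mu> = real (N ^ m)"
    proof -
      have "(x / c) powr \<mu> = (real N powr real n) powr \<mu>" using c N by (simp add: x powr_realpow)
      also have "\<dots> = real N powr real m" using assms(1) by (simp add: powr_powr \<mu>_def)
      finally show ?thesis using N by (simp add: powr_realpow)
    qed
    then have "(x / c) powr \<mu> * ln 2 = ln (2 ^ (N ^ m))" by (simp add: ln_realpow)
    also have "\<dots> \<le> ln (?P ^ ?e)" using count P1 by (intro ln_mono) auto
    also have "\<dots> = real (2 * L + 6) * real (W + 1) * ln ?P"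
      by (simp only: ln_realpow of_nat_mult)
    also have "\<dots> \<le> rhs x"
      unfolding rhs_def
    proof (intro mult_mono)
      show "ln ?P \<le> ln (64 * x * (C\<^sub>0 * ln (2 * x) powr (\<kappa> + 1) + 1) *
          (C\<^sub>0 * x powr \<gamma>' + (real CARD('d) + 2)) * (C\<^sub>0 * x powr (\<theta> + 1) + 1))"
        using P1 L W K' x2 K assms(5) by (intro ln_mono mult_mono add_right_mono) auto
    qed (use L W P1 assms(5) in auto)
    finally show ?thesis .
  qed
  have "\<forall>\<^sub>F x in at_top. rhs x < (x / c) powr \<mu> * ln 2"
    unfolding rhs_def using \<gamma>' assms c by (intro polynomial_growth_dominates) auto
  moreover have "filterlim (\<lambda>N. c * real N ^ n) at_top at_top"
    using c assms(1) by real_asymp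
  ultimately have "\<forall>\<^sub>F N in at_top. rhs (c * real N ^ n) < (c * real N ^ n / c) powr \<mu> * ln 2"
    by (rule eventually_compose_filterlim)
  then have "\<forall>\<^sub>F N in at_top. 1 \<le> N \<and> rhs (c * real N ^ n) < (c * real N ^ n / c) powr \<mu> * ln 2"
    using eventually_ge_at_top[of 1] by eventually_elim auto
  then obtain N where "1 \<le> N" "rhs (c * real N ^ n) < (c * real N ^ n / c) powr \<mu> * ln 2"
    using eventually_happens'[OF trivial_limit_sequentially] by blast
  with lower[of N, OF _ refl] show False by linarith
qed

end
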